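(* Let $m\ge1$, let $\nu_m$ be the product measure on $X$ described in the context, and let $X_h(t,x_h)$, $h\in\mathbb{N}$, be the solutions of the stochastic differential equations $$dX_h=-\frac1{2\mu_h}|X_h|^{2m-2}X_h\,dt+dW_h(t),\qquad X_h(0)=x_h\in\mathbb{R}.$$ For any $x\in X$ define $$X(t,x):=\sum_{h=1}^\infty X_h(t,x_h)e_h,\qquad t\ge0.$$ Then $X(t,x)$, $t\ge0$, is a stochastic process in $X$. Moreover, defining the corresponding transition semigroup by $P_t\varphi(x):=\mathbb{E}[\varphi(X(t,x))]$ for $\varphi\in C_b(X)$, $\nu_m$ is an invariant measure of $P_t$, i.e. $\int_XP_t\varphi\,d\nu_m=\int_X\varphi\,d\nu_m$ for all $\varphi\in C_b(X)$, $t\ge0$.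
   Context: $X$ is a separable infinite-dimensional real Hilbert space with a fixed orthonormal basis $\{e_h\}_{h\in\mathbb{N}}$; $x_h=\langle x,e_h\rangle$, and $X$ is identified with $\ell^2$ via $x\mapsto(x_h)$. $C_b(X)$ is the space of bounded continuous real functions on $X$. For $\mu>0$, $\nu_{m,\mu}(d\xi)=a_m\mu^{-1/(2m)}e^{-|\xi|^{2m}/(2m\mu)}\,d\xi$ on $\mathbb{R}$, with $a_m=(2m)^{1-1/(2m)}/(2\Gamma(1/(2m)))$ the normalization constant making it a probability measure. $(\mu_h)_{h\in\mathbb{N}}$ is a sequence of positive numbers with $\sum_{h=1}^\infty\mu_h^{1/m}<\infty$, and $\nu_m=\prod_{h=1}^\infty\nu_{m,\mu_h}$, a product measure on $\mathbb{R}^\infty$ concentrated on $\ell^2\cong X$. $(W_h)_{h\in\mathbb{N}}$ is a sequence of mutually independent real Brownian motions on a probability space $(\Omega,\mathcal{F},\mathbb{P})$; for every $h\in\mathbb{N}$ and $x_h\in\mathbb{R}$ the stochastic differential equation $dX_h=-\frac1{2\mu_h}|X_h|^{2m-2}X_h\,dt+dW_h(t)$, $X_h(0)=x_h$, has a unique solution $X_h(t,x_h)$. *)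

theory Defs
  imports "HOL-Probability.Probability"
begin

definition orthonormal_basis :: "(nat \<Rightarrow> 'a::real_inner) \<Rightarrow> bool" where
  "orthonormal_basis e \<longleftrightarrow>
     (\<forall>i j. e i \<bullet> e j = (if i = j then 1 else 0)) \<and> closure (span (range e)) = UNIV"

definition nu1 :: "real \<Rightarrow> real \<Rightarrow> real measure" where
  "nu1 m \<mu> = density lborel (\<lambda>\<xi>. ennreal
     ((2 * m) powr (1 - 1 / (2 * m)) / (2 * Gamma (1 / (2 * m)))
        * \<mu> powr (- 1 / (2 * m)) * exp (- (\<bar>\<xi>\<bar> powr (2 * m)) / (2 * m * \<mu>))))"

text \<open>
  The product measure lives on all real sequences and is concentrated on the square-summable
  ones; it is transported to \<open>X\<close> by the identification of \<open>(\<xi> h)\<close> with the sum of the series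
  \<open>\<xi> h *\<^sub>R e h\<close>.  Off the square-summable sequences (a null set) the series diverges and
  \<open>suminf\<close> takes a fixed value, so the map is Borel measurable.
\<close>

definition nu_on_sequences :: "real \<Rightarrow> (nat \<Rightarrow> real) \<Rightarrow> (nat \<Rightarrow> real) measure" where
  "nu_on_sequences m \<mu> = (\<Pi>\<^sub>M h\<in>UNIV. nu1 m (\<mu> h))"

definition nu :: "(nat \<Rightarrow> 'a::{real_inner, banach, second_countable_topology}) \<Rightarrow>
    real \<Rightarrow> (nat \<Rightarrow> real) \<Rightarrow> 'a measure" where
  "nu e m \<mu> = distr (nu_on_sequences m \<mu>) borel (\<lambda>\<xi>. \<Sum>h. \<xi> h *\<^sub>R e h)"

lemma measurable_sequence_to_space:
  fixes e :: "nat \<Rightarrow> 'a::{real_inner, banach, second_countable_topology}"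
  shows "(\<lambda>\<xi>. \<Sum>h. \<xi> h *\<^sub>R e h) \<in> nu_on_sequences m \<mu> \<rightarrow>\<^sub>M borel"
proof (rule borel_measurable_suminf)
  fix h
  have "(\<lambda>\<xi>. \<xi> h) \<in> nu_on_sequences m \<mu> \<rightarrow>\<^sub>M nu1 m (\<mu> h)"
    unfolding nu_on_sequences_def by (rule measurable_component_singleton) simp
  then have "(\<lambda>\<xi>. \<xi> h) \<in> borel_measurable (nu_on_sequences m \<mu>)"
    by (simp add: nu1_def cong: measurable_cong_sets)
  then show "(\<lambda>\<xi>. \<xi> h *\<^sub>R e h) \<in> borel_measurable (nu_on_sequences m \<mu>)"
    by simp
qed

text \<open>Processes are functions of a real time that matter only on \<open>{0..}\<close>.\<close>

definition stochastic_process :: "'w measure \<Rightarrow> (real \<Rightarrow> 'w \<Rightarrow> 'b::topological_space) \<Rightarrow> bool" where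
  "stochastic_process M Y \<longleftrightarrow> (\<forall>t\<ge>0. Y t \<in> borel_measurable M)"

definition brownian_motion :: "'w measure \<Rightarrow> (real \<Rightarrow> 'w \<Rightarrow> real) \<Rightarrow> bool" where
  "brownian_motion M W \<longleftrightarrow>
     stochastic_process M W \<and>
     (AE \<omega> in M. W 0 \<omega> = 0) \<and>
     (AE \<omega> in M. continuous_on {0..} (\<lambda>t. W t \<omega>)) \<and>
     (\<forall>s t. 0 \<le> s \<and> s < t \<longrightarrow>
        distributed M lborel (\<lambda>\<omega>. W t \<omega> - W s \<omega>) (normal_density 0 (sqrt (t - s)))) \<and>
     (\<forall>(n::nat) \<tau>. 0 \<le> \<tau> 0 \<and> (\<forall>i<n. \<tau> i \<le> \<tau> (Suc i)) \<longrightarrow>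
        prob_space.indep_vars M (\<lambda>_. borel) (\<lambda>i \<omega>. W (\<tau> (Suc i)) \<omega> - W (\<tau> i) \<omega>) {..<n})"

definition independent_processes :: "'w measure \<Rightarrow> (nat \<Rightarrow> real \<Rightarrow> 'w \<Rightarrow> real) \<Rightarrow> bool" where
  "independent_processes M W \<longleftrightarrow>
     prob_space.indep_vars M (\<lambda>_. \<Pi>\<^sub>M t\<in>{0..}. borel) (\<lambda>h \<omega>. \<lambda>t\<in>{0..}. W h t \<omega>) UNIV"

text \<open>The natural filtration of \<open>W\<close>, augmented by the null sets of \<open>M\<close>.\<close>

definition augmented_filtration :: "'w measure \<Rightarrow> (real \<Rightarrow> 'w \<Rightarrow> real) \<Rightarrow> real \<Rightarrow> 'w measure" where
  "augmented_filtration M W t =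
     sigma (space M)
       ({W s -` A \<inter> space M | s A. 0 \<le> s \<and> s \<le> t \<and> A \<in> sets borel} \<union> null_sets M)"

text \<open>
  Strong solution of \<open>dY = b(Y) dt + dW\<close>, \<open>Y(0) = x\<close>.  For continuous \<open>b\<close> the integrand is
  continuous on almost every path, so the time integral is an ordinary Riemann integral.
\<close>

definition sde_solution :: "'w measure \<Rightarrow> (real \<Rightarrow> 'w \<Rightarrow> real) \<Rightarrow> (real \<Rightarrow> real) \<Rightarrow> real \<Rightarrow>
    (real \<Rightarrow> 'w \<Rightarrow> real) \<Rightarrow> bool" where
  "sde_solution M W b x Y \<longleftrightarrow>
     (\<forall>t\<ge>0. Y t \<in> borel_measurable (augmented_filtration M W t)) \<and>
     (AE \<omega> in M. continuous_on {0..} (\<lambda>t. Y t \<omega>)) \<and>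
     (AE \<omega> in M. \<forall>t\<ge>0. Y t \<omega> = x + integral {0..t} (\<lambda>s. b (Y s \<omega>)) + W t \<omega>)"

text \<open>At \<open>m = 1\<close>, \<open>y = 0\<close> the convention \<open>0 powr 0 = 0\<close> is harmless because of the factor \<open>y\<close>.\<close>

definition drift :: "real \<Rightarrow> real \<Rightarrow> real \<Rightarrow> real" where
  "drift m \<mu> y = - 1 / (2 * \<mu>) * \<bar>y\<bar> powr (2 * m - 2) * y"

definition process :: "(nat \<Rightarrow> 'a::{real_inner, banach}) \<Rightarrow> (nat \<Rightarrow> real \<Rightarrow> real \<Rightarrow> 'w \<Rightarrow> real) \<Rightarrow>
    real \<Rightarrow> 'a \<Rightarrow> 'w \<Rightarrow> 'a" where
  "process e Xh t x \<omega> = (\<Sum>h. Xh h t (x \<bullet> e h) \<omega> *\<^sub>R e h)"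

definition transition_semigroup :: "'w measure \<Rightarrow> (real \<Rightarrow> 'a \<Rightarrow> 'w \<Rightarrow> 'a) \<Rightarrow>
    real \<Rightarrow> ('a \<Rightarrow> real) \<Rightarrow> 'a \<Rightarrow> real" where
  "transition_semigroup M Y t \<phi> x = (\<integral>\<omega>. \<phi> (Y t x \<omega>) \<partial>M)"

text \<open>
  The integrability clause makes the left-hand integral meaningful; the Bochner integral of a
  non-integrable function is 0 by convention.
\<close>

definition invariant_measure :: "(real \<Rightarrow> ('a::metric_space \<Rightarrow> real) \<Rightarrow> 'a \<Rightarrow> real) \<Rightarrow>
    'a measure \<Rightarrow> bool" where
  "invariant_measure P \<nu> \<longleftrightarrow>
     (\<forall>t\<ge>0. \<forall>\<phi>\<in>bcontfun. integrable \<nu> (P t \<phi>) \<and> (\<integral>x. P t \<phi> x \<partial>\<nu>) = (\<integral>x. \<phi> x \<partial>\<nu>))"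

end

theory Submission
  imports Defs
begin

text \<open>
  Write \<open>b\<close> for the drift of one coordinate. Since \<open>b\<close> is decreasing and the noise is additive, a
  solution is, path by path, the limit of the backward Euler scheme
  \<open>X\<^sub>k\<^sub>+\<^sub>1 = J (X\<^sub>k + \<Delta>W\<^sub>k)\<close> with the resolvent \<open>J = (1 - d b)\<^sup>-\<^sup>1\<close>, which is a contraction
  (\<open>euler_at_converges\<close>). Hence the solution at time \<open>t\<close> agrees almost surely with a functional
  \<open>flow\<close> of the initial value and the driving path. The functional is jointly
  measurable and, where the scheme converges, 1-Lipschitz in the initial value, whereas the given solutions are determined only
  up to null sets that depend on the initial value.

  In one dimension, let \<open>F\<close> be the distribution function and \<open>p\<close> the density of \<open>\<nu>\<^sub>m\<^sub>,\<^sub>\<mu>\<close>; then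
  \<open>p' = 2 b p\<close>. Adding an independent centred Gaussian variable of variance \<open>d\<close> changes \<open>F\<close> by
  \<open>(d/2) p' + O(d\<^sup>3\<^sup>/\<^sup>2)\<close>. Applying \<open>J\<close> replaces \<open>F z\<close> by \<open>F (z - d b z)\<close>, that is, changes it by
  \<open>- d b p + O(d\<^sup>2)\<close>. The terms of order \<open>d\<close> cancel, and both remainders are dominated by a multiple
  of \<open>1 / (1 + z\<^sup>2)\<close>. By the duality between Lipschitz functions and the \<open>L\<^sup>1\<close> distance of distribution
  functions (\<open>lipschitz_expectation_diff_le\<close>), one step of the scheme changes the integral of an
  \<open>L\<close>-Lipschitz function by at most \<open>L O(d\<^sup>3\<^sup>/\<^sup>2)\<close> (\<open>one_step_error\<close>). Because \<open>J\<close> contracts, the scheme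
  never increases Lipschitz constants, so the errors of \<open>n\<close> steps of size \<open>t/n\<close> merely add up, to
  \<open>O(n\<^sup>-\<^sup>1\<^sup>/\<^sup>2)\<close>, and the flow preserves the measure exactly (\<open>flow_preserves_gibbs\<close>).

  For the whole sequence, independent initial values and independent driving paths give
  independent coordinates, so the coordinatewise flow preserves the product measure
  (\<open>distr_PiM_independent_maps\<close>). The second moment of \<open>\<nu>\<^sub>m\<^sub>,\<^sub>\<mu>\<close> is a multiple of \<open>\<mu>\<^sup>1\<^sup>/\<^sup>m\<close>, so almost
  every sequence is square summable. Therefore some square summable \<open>\<xi>\<close> has an almost surely
  square summable solution, and contraction transfers this to every \<open>x\<close> through
  \<open>\<bar>X\<^sub>h(t, x\<^sub>h)\<bar> \<le> \<bar>x\<^sub>h - \<xi>\<^sub>h\<bar> + \<bar>X\<^sub>h(t, \<xi>\<^sub>h)\<bar>\<close>. The invariance of \<open>\<nu>\<^sub>m\<close> is then Fubini's theorem.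
\<close>

section \<open>Orthonormal expansions\<close>

context
  fixes e :: "nat \<Rightarrow> 'a::{real_inner, banach}"
  assumes on: "\<And>i j. e i \<bullet> e j = (if i = j then 1 else 0)"
begin

lemma orthonormal_norm_sum:
  assumes "finite A"
  shows "(norm (\<Sum>h\<in>A. c h *\<^sub>R e h))\<^sup>2 = (\<Sum>h\<in>A. (c h)\<^sup>2)"
  using assms unfolding power2_norm_eq_inner
  by (simp add: inner_sum_left inner_sum_right on power2_eq_square
      if_distrib [of "\<lambda>x. _ * x"] cong: if_cong)

lemma orthonormal_summable:
  assumes "summable (\<lambda>h. (c h)\<^sup>2)"
  shows "summable (\<lambda>h. c h *\<^sub>R e h)"
  unfolding summable_Cauchy
proof (intro allI impI)
  fix r :: real assume "r > 0"
  then obtain N where N: "\<And>m n. m \<ge> N \<Longrightarrow> norm (\<Sum>h=m..<n. (c h)\<^sup>2) < r\<^sup>2"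
    using assms unfolding summable_Cauchy by (meson zero_less_power)
  have "norm (\<Sum>h=m..<n. c h *\<^sub>R e h) < r" if "m \<ge> N" for m n
  proof (rule power2_less_imp_less)
    show "(norm (\<Sum>h=m..<n. c h *\<^sub>R e h))\<^sup>2 < r\<^sup>2"
      using N[OF that, of n] by (simp add: orthonormal_norm_sum sum_nonneg)
  qed (use \<open>r > 0\<close> in simp)
  then show "\<exists>N. \<forall>m\<ge>N. \<forall>n. norm (\<Sum>h=m..<n. c h *\<^sub>R e h) < r" by blast
qed

lemma orthonormal_coeff:
  assumes "summable (\<lambda>h. c h *\<^sub>R e h)"
  shows "(\<Sum>h. c h *\<^sub>R e h) \<bullet> e k = c k"
proof -
  have "(\<Sum>h. c h *\<^sub>R e h) \<bullet> e k = (\<Sum>h. (c h *\<^sub>R e h) \<bullet> e k)"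
    by (rule bounded_linear.suminf[OF bounded_linear_inner_left assms])
  also have "\<dots> = (\<Sum>h. if h = k then c h else 0)"
    by (intro suminf_cong) (simp add: on)
  also have "\<dots> = c k"
    using suminf_finite[of "{k}" "\<lambda>h. if h = k then c h else 0"] by simp
  finally show ?thesis .
qed

lemma bessel_summable: "summable (\<lambda>h. (x \<bullet> e h)\<^sup>2)"
proof (rule summableI_nonneg_bounded)
  fix n
  define p where "p = (\<Sum>h<n. (x \<bullet> e h) *\<^sub>R e h)"
  have px: "x \<bullet> p = (\<Sum>h<n. (x \<bullet> e h)\<^sup>2)"
    by (simp add: p_def inner_sum_right power2_eq_square)
  have pp: "p \<bullet> p = (\<Sum>h<n. (x \<bullet> e h)\<^sup>2)"
    using orthonormal_norm_sum[of "{..<n}" "\<lambda>h. x \<bullet> e h"] by (simp add: p_def power2_norm_eq_inner)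
  have "0 \<le> (x - p) \<bullet> (x - p)" by simp
  also have "\<dots> = x \<bullet> x - (\<Sum>h<n. (x \<bullet> e h)\<^sup>2)"
    by (simp add: inner_diff_left inner_diff_right px pp inner_commute[of p x])
  finally show "(\<Sum>h<n. (x \<bullet> e h)\<^sup>2) \<le> x \<bullet> x" by simp
qed simp

end

lemma square_summable_perturb:
  fixes a b :: "nat \<Rightarrow> real"
  assumes "summable (\<lambda>h. (a h)\<^sup>2)" "summable (\<lambda>h. (b h)\<^sup>2)"
    and "\<And>h. \<bar>c h\<bar> \<le> \<bar>a h\<bar> + \<bar>b h\<bar>"
  shows "summable (\<lambda>h. (c h)\<^sup>2)"
proof (rule summable_comparison_test')
  show "summable (\<lambda>h. 2 * (a h)\<^sup>2 + 2 * (b h)\<^sup>2)"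
    by (intro summable_add summable_mult assms)
  fix h
  have "(c h)\<^sup>2 \<le> (\<bar>a h\<bar> + \<bar>b h\<bar>)\<^sup>2"
    by (metis abs_ge_zero assms(3) power2_abs power_mono)
  also have "\<dots> \<le> 2 * (a h)\<^sup>2 + 2 * (b h)\<^sup>2"
    using sum_squares_bound[of "\<bar>a h\<bar>" "\<bar>b h\<bar>"] by (simp add: power2_sum)
  finally show "norm ((c h)\<^sup>2) \<le> 2 * (a h)\<^sup>2 + 2 * (b h)\<^sup>2" by simp
qed

section \<open>The implicit Euler scheme for a decreasing drift\<close>

locale decreasing_drift =
  fixes b :: "real \<Rightarrow> real"
  assumes b_cont: "continuous_on UNIV b"
    and b_antimono: "\<And>x y. x \<le> y \<Longrightarrow> b y \<le> b x"
begin

text \<open>Both summands of \<open>v - d b v\<close> increase with \<open>v\<close>, so their increments have the same sign.\<close>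

lemma implicit_step_expanding:
  assumes "d \<ge> 0"
  shows "\<bar>v - w\<bar> \<le> \<bar>(v - d * b v) - (w - d * b w)\<bar>"
proof (cases "v \<le> w")
  case True
  then have "d * b w \<le> d * b v" using b_antimono assms by (simp add: mult_left_mono)
  with True show ?thesis by simp
next
  case False
  then have "d * b v \<le> d * b w" using b_antimono[of w v] assms by (simp add: mult_left_mono)
  with False show ?thesis by simp
qed

lemma implicit_step_solvable:
  assumes "d \<ge> 0"
  shows "\<exists>!v. v - d * b v = u"
proof (rule ex_ex1I)
  define g where "g = (\<lambda>v. v - d * b v)"
  \<comment> \<open>outside \<open>[-r, r]\<close> the function \<open>g\<close> has passed \<open>u\<close>, since \<open>\<bar>g v - g 0\<bar> \<ge> \<bar>v\<bar>\<close>\<close>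
  define r where "r = \<bar>u + d * b 0\<bar>"
  have "r \<ge> 0" by (simp add: r_def)
  have mono: "d * b y \<le> d * b x" if "x \<le> y" for x y
    using b_antimono[OF that] assms by (simp add: mult_left_mono)
  have "g (- r) \<le> u" "u \<le> g r"
    using mono[of "-r" 0] mono[of 0 r] \<open>r \<ge> 0\<close> by (auto simp: g_def r_def)
  moreover have "continuous_on {-r..r} g"
    unfolding g_def by (intro continuous_intros continuous_on_subset[OF b_cont]) auto
  ultimately obtain v where "g v = u"
    using IVT'[of g "-r" u r] \<open>r \<ge> 0\<close> by auto
  then show "\<exists>v. v - d * b v = u" unfolding g_def by blast
next
  fix v w assume "v - d * b v = u" "w - d * b w = u"
  then show "v = w" using implicit_step_expanding[OF assms, of v w] by simp
qed

definition resolvent :: "real \<Rightarrow> real \<Rightarrow> real" where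
  "resolvent d u = (THE v. v - d * b v = u)"

lemma resolvent_eq: "d \<ge> 0 \<Longrightarrow> resolvent d u - d * b (resolvent d u) = u"
  unfolding resolvent_def by (rule theI'[OF implicit_step_solvable])

lemma resolvent_unique: "d \<ge> 0 \<Longrightarrow> v - d * b v = u \<Longrightarrow> resolvent d u = v"
  using implicit_step_solvable[of d u] resolvent_eq[of d u] by blast

lemma resolvent_contraction:
  "d \<ge> 0 \<Longrightarrow> \<bar>resolvent d u - resolvent d v\<bar> \<le> \<bar>u - v\<bar>"
  using implicit_step_expanding[of d "resolvent d u" "resolvent d v"] by (simp add: resolvent_eq)

text \<open>
  This turns the law of \<open>resolvent d U\<close> into the law of \<open>U\<close> read at the explicit point \<open>z - d b z\<close>,
  so that the resolvent itself never has to be expanded in \<open>d\<close>.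
\<close>

lemma resolvent_le_iff:
  assumes "d \<ge> 0"
  shows "resolvent d u \<le> z \<longleftrightarrow> u \<le> z - d * b z"
proof
  assume "resolvent d u \<le> z"
  then have "d * b z \<le> d * b (resolvent d u)"
    using b_antimono assms by (simp add: mult_left_mono)
  with \<open>resolvent d u \<le> z\<close> resolvent_eq[OF assms, of u] show "u \<le> z - d * b z" by linarith
next
  assume *: "u \<le> z - d * b z"
  show "resolvent d u \<le> z"
  proof (rule ccontr)
    assume "\<not> ?thesis"
    then have "d * b (resolvent d u) \<le> d * b z" "z < resolvent d u"
      using b_antimono assms by (simp_all add: mult_left_mono)
    with * resolvent_eq[OF assms, of u] show False by linarith
  qed
qed

lemma resolvent_measurable[measurable]:
  assumes "d \<ge> 0"
  shows "resolvent d \<in> borel_measurable borel"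
proof (rule borel_measurable_continuous_onI)
  have "1-lipschitz_on UNIV (resolvent d)"
    using resolvent_contraction[OF assms] by (intro lipschitz_onI) (auto simp: dist_real_def)
  then show "continuous_on UNIV (resolvent d)" by (rule lipschitz_on_continuous_on)
qed

fun implicit_euler :: "real \<Rightarrow> (nat \<Rightarrow> real) \<Rightarrow> nat \<Rightarrow> real \<Rightarrow> real" where
  "implicit_euler d \<Delta> 0 x = x"
| "implicit_euler d \<Delta> (Suc k) x = resolvent d (implicit_euler d \<Delta> k x + \<Delta> k)"

lemma implicit_euler_contraction:
  "d \<ge> 0 \<Longrightarrow> \<bar>implicit_euler d \<Delta> k x - implicit_euler d \<Delta> k y\<bar> \<le> \<bar>x - y\<bar>"
proof (induction k)
  case (Suc k)
  then show ?case
    using resolvent_contraction[of d "implicit_euler d \<Delta> k x + \<Delta> k" "implicit_euler d \<Delta> k y + \<Delta> k"]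
    by simp
qed simp

lemma implicit_euler_cong:
  "(\<And>i. i < k \<Longrightarrow> \<Delta> i = \<Delta>' i) \<Longrightarrow> implicit_euler d \<Delta> k x = implicit_euler d \<Delta>' k x"
  by (induction k) auto

lemma implicit_euler_measurable:
  assumes "d \<ge> 0" "g \<in> borel_measurable N" "\<And>i. i < k \<Longrightarrow> (\<lambda>z. \<Delta> z i) \<in> borel_measurable N"
  shows "(\<lambda>z. implicit_euler d (\<Delta> z) k (g z)) \<in> borel_measurable N"
  using assms(3)
proof (induction k)
  case (Suc k)
  have [measurable]: "(\<lambda>z. implicit_euler d (\<Delta> z) k (g z)) \<in> borel_measurable N"
    "(\<lambda>z. \<Delta> z k) \<in> borel_measurable N"
    using Suc by auto
  have [measurable]: "resolvent d \<in> borel_measurable borel" using assms by simp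
  show ?case by simp
qed (use assms in simp)

text \<open>
  A sequence that satisfies the scheme up to a residual \<open>\<rho>\<close> is itself an exact step of the scheme
  from the point perturbed by \<open>\<rho>\<close>. As steps contract, residuals accumulate at most linearly.
\<close>

lemma implicit_euler_error:
  assumes "d \<ge> 0" "y 0 = x"
    and "\<And>k. k < n \<Longrightarrow> \<bar>y (Suc k) - y k - \<Delta> k - d * b (y (Suc k))\<bar> \<le> r"
    and "k \<le> n"
  shows "\<bar>y k - implicit_euler d \<Delta> k x\<bar> \<le> k * r"
  using \<open>k \<le> n\<close>
proof (induction k)
  case (Suc k)
  \<comment> \<open>the residual, read as a perturbation of the previous point\<close>
  define \<rho> where "\<rho> = y (Suc k) - y k - \<Delta> k - d * b (y (Suc k))"
  have "y (Suc k) = resolvent d (y k + \<Delta> k + \<rho>)"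
    by (rule resolvent_unique[symmetric, OF assms(1)]) (simp add: \<rho>_def)
  then have "\<bar>y (Suc k) - implicit_euler d \<Delta> (Suc k) x\<bar> \<le> \<bar>y k - implicit_euler d \<Delta> k x + \<rho>\<bar>"
    using resolvent_contraction[OF assms(1), of "y k + \<Delta> k + \<rho>" "implicit_euler d \<Delta> k x + \<Delta> k"]
    by (simp add: algebra_simps)
  also have "\<dots> \<le> k * r + r"
    using Suc assms(3)[of k] unfolding \<rho>_def by simp
  finally show ?case by (simp add: algebra_simps)
qed (use assms in simp)

definition euler_at :: "real \<Rightarrow> nat \<Rightarrow> real \<Rightarrow> (real \<Rightarrow> real) \<Rightarrow> real" where
  "euler_at t n x w =
     implicit_euler (t / n) (\<lambda>k. w (t * real (Suc k) / n) - w (t * real k / n)) n x"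

text \<open>
  On a fixed path the function \<open>s \<mapsto> b (Y s)\<close> is uniformly continuous on \<open>[0, t]\<close>. Replacing its
  integral over one of the \<open>n\<close> time steps by the value at the right end point costs \<open>o(1/n)\<close>, hence
  \<open>o(1)\<close> in total.
\<close>

lemma euler_at_converges:
  assumes "t \<ge> 0"
    and Yc: "continuous_on {0..} Y"
    and Y: "\<And>s. s \<ge> 0 \<Longrightarrow> Y s = x + integral {0..s} (\<lambda>r. b (Y r)) + w s"
    and "w 0 = 0"
  shows "(\<lambda>n. euler_at t (Suc n) x w) \<longlonglongrightarrow> Y t"
proof (cases "t = 0")
  case True
  have "implicit_euler 0 (\<lambda>_. 0) k x = x" for k
    by (induction k) (auto intro: resolvent_unique)
  then show ?thesis using True Y[of 0] assms by (simp add: euler_at_def del: implicit_euler.simps)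
next
  case False
  then have "t > 0" using assms by simp
  define g where "g s = b (Y s)" for s
  have gc: "continuous_on {0..t} g"
    unfolding g_def
    by (rule continuous_on_compose2[OF b_cont continuous_on_subset[OF Yc]]) auto
  then have gu: "uniformly_continuous_on {0..t} g"
    by (intro compact_uniformly_continuous) auto
  show ?thesis
  proof (rule LIMSEQ_I)
    fix r :: real assume "r > 0"
    define \<epsilon> where "\<epsilon> = r / (2 * t)"
    have "\<epsilon> > 0" using \<open>r > 0\<close> \<open>t > 0\<close> by (simp add: \<epsilon>_def)
    then obtain \<eta> where \<eta>: "\<eta> > 0" "\<And>p q. p \<in> {0..t} \<Longrightarrow> q \<in> {0..t} \<Longrightarrow> \<bar>p - q\<bar> < \<eta> \<Longrightarrow> \<bar>g p - g q\<bar> < \<epsilon>"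
      using gu unfolding uniformly_continuous_on_def dist_real_def by metis
    obtain N where N: "t / real (Suc N) < \<eta>"
      using reals_Archimedean[of "\<eta> / t"] \<eta>(1) \<open>t > 0\<close>
      by (auto simp: field_simps)
    have "\<bar>euler_at t (Suc n) x w - Y t\<bar> < r" if "n \<ge> N" for n
    proof -
      define d where "d = t / real (Suc n)"
      define T where "T k = t * real k / real (Suc n)" for k
      have "d \<le> t / real (Suc N)"
        using \<open>t > 0\<close> that unfolding d_def by (intro divide_left_mono) auto
      then have d: "d > 0" "d < \<eta>"
        using N \<open>t > 0\<close> by (auto simp: d_def)
      have Tstep: "T (Suc k) = T k + d" for k
        unfolding T_def d_def add_divide_distrib[symmetric] by (simp add: algebra_simps)
      have T0: "0 \<le> T k" for k using \<open>t > 0\<close> by (simp add: T_def)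
      have Tt: "T k \<le> t" if "k \<le> Suc n" for k
        using that \<open>t > 0\<close> mult_left_mono[of "real k" "real (Suc n)" t]
        by (simp add: T_def divide_le_eq del: of_nat_Suc)
      have err: "\<bar>Y (T (Suc k)) - Y (T k) - (w (T (Suc k)) - w (T k)) - d * b (Y (T (Suc k)))\<bar> \<le> d * \<epsilon>"
        if "k < Suc n" for k
      proof -
        have le: "T k \<le> T (Suc k)" using Tstep d by simp
        have sub: "{T k..T (Suc k)} \<subseteq> {0..t}" using T0[of k] Tt[of "Suc k"] that by auto
        have int: "g integrable_on {0..T (Suc k)}"
          by (rule integrable_continuous_interval, rule continuous_on_subset[OF gc])
             (use Tt[of "Suc k"] that in auto)
        have int': "g integrable_on {T k..T (Suc k)}"
          by (rule integrable_continuous_interval, rule continuous_on_subset[OF gc sub])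
        have "integral {0..T (Suc k)} g = integral {0..T k} g + integral {T k..T (Suc k)} g"
          using Henstock_Kurzweil_Integration.integral_combine[OF T0 le int] by simp
        then have "Y (T (Suc k)) - Y (T k) - (w (T (Suc k)) - w (T k)) = integral {T k..T (Suc k)} g"
          using Y[OF T0[of k]] Y[OF T0[of "Suc k"]] by (simp add: g_def[abs_def])
        also have "\<dots> - d * g (T (Suc k)) = integral {T k..T (Suc k)} (\<lambda>s. g s - g (T (Suc k)))"
          using int' le Tstep[of k] by (subst Henstock_Kurzweil_Integration.integral_diff) auto
        finally have eq: "Y (T (Suc k)) - Y (T k) - (w (T (Suc k)) - w (T k)) - d * g (T (Suc k))
            = integral {T k..T (Suc k)} (\<lambda>s. g s - g (T (Suc k)))" .
        have "norm (integral {T k..T (Suc k)} (\<lambda>s. g s - g (T (Suc k)))) \<le> \<epsilon> * (T (Suc k) - T k)"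
        proof (rule integral_bound[OF le])
          show "continuous_on {T k..T (Suc k)} (\<lambda>s. g s - g (T (Suc k)))"
            by (intro continuous_intros continuous_on_subset[OF gc sub])
          fix s assume s: "s \<in> {T k..T (Suc k)}"
          then have "\<bar>s - T (Suc k)\<bar> < \<eta>" using Tstep[of k] d by auto
          then show "norm (g s - g (T (Suc k))) \<le> \<epsilon>"
            using \<eta>(2)[of s "T (Suc k)"] s sub le by fastforce
        qed
        then show ?thesis using eq Tstep[of k] by (simp add: g_def mult.commute)
      qed
      have "\<bar>Y (T (Suc n)) - implicit_euler d (\<lambda>k. w (T (Suc k)) - w (T k)) (Suc n) x\<bar>
          \<le> real (Suc n) * (d * \<epsilon>)"
      proof (rule implicit_euler_error[where y = "\<lambda>k. Y (T k)" and n = "Suc n"])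
        show "Y (T 0) = x" using Y[of 0] \<open>w 0 = 0\<close> by (simp add: T_def)
      qed (use d err in auto)
      also have "real (Suc n) * (d * \<epsilon>) = r / 2"
        using \<open>t > 0\<close> by (simp add: d_def \<epsilon>_def del: of_nat_Suc)
      also have "\<dots> < r" using \<open>r > 0\<close> by simp
      finally show ?thesis
        unfolding euler_at_def d_def T_def using \<open>t > 0\<close> by (simp add: abs_minus_commute del: of_nat_Suc implicit_euler.simps)
    qed
    then show "\<exists>N. \<forall>n\<ge>N. norm (euler_at t (Suc n) x w - Y t) < r" by auto
  qed
qed

end

section \<open>Lipschitz test functions and distribution functions\<close>

lemma antiderivative_real:
  fixes f :: "real \<Rightarrow> real"
  assumes "continuous_on UNIV f"
  shows "\<exists>F. \<forall>x. (F has_real_derivative f x) (at x)"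
proof -
  have "\<exists>F. \<forall>x::real. -\<infinity> < ereal x \<longrightarrow> ereal x < \<infinity> \<longrightarrow> (F has_vector_derivative f x) (at x)"
    using assms by (intro einterval_antiderivative) (auto simp: continuous_on_eq_continuous_at)
  then show ?thesis by (simp add: has_real_derivative_iff_has_vector_derivative)
qed

lemma lipschitz_real_continuous:
  fixes f :: "real \<Rightarrow> real"
  assumes "\<And>x y. \<bar>f x - f y\<bar> \<le> L * \<bar>x - y\<bar>"
  shows "continuous_on UNIV f"
proof -
  have "0 \<le> L" using assms[of 1 0] by simp
  then have "L-lipschitz_on UNIV f" using assms by (intro lipschitz_onI) (auto simp: dist_real_def)
  then show ?thesis by (rule lipschitz_on_continuous_on)
qed

text \<open>Averaging over \<open>[x, x + \<epsilon>]\<close> smooths \<open>f\<close> without increasing its Lipschitz constant.\<close>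

lemma lipschitz_smooth_approx:
  fixes f :: "real \<Rightarrow> real"
  assumes lip: "\<And>x y. \<bar>f x - f y\<bar> \<le> L * \<bar>x - y\<bar>" and "\<epsilon> > 0"
  obtains F F' where "\<And>x. (F has_real_derivative F' x) (at x)" "continuous_on UNIV F'"
    "\<And>x. \<bar>F' x\<bar> \<le> L" "\<And>x. \<bar>F x - f x\<bar> \<le> L * \<epsilon>"
proof -
  note fc = lipschitz_real_continuous[OF lip]
  have "0 \<le> L" using lip[of 1 0] by simp
  obtain I where I: "\<And>x. (I has_real_derivative f x) (at x)"
    using antiderivative_real[OF fc] by auto
  show thesis
  proof
    show "((\<lambda>x. (I (x + \<epsilon>) - I x) / \<epsilon>) has_real_derivative (f (x + \<epsilon>) - f x) / \<epsilon>) (at x)" for x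
      using I[of "x + \<epsilon>"] I[of x] by (intro DERIV_cdivide DERIV_diff) (simp_all add: DERIV_shift)
    show "continuous_on UNIV (\<lambda>x. (f (x + \<epsilon>) - f x) / \<epsilon>)"
      using \<open>\<epsilon> > 0\<close> by (intro continuous_intros continuous_on_compose2[OF fc] fc) auto
    show "\<bar>(f (x + \<epsilon>) - f x) / \<epsilon>\<bar> \<le> L" for x
      using lip[of "x + \<epsilon>" x] \<open>\<epsilon> > 0\<close> by (simp add: field_simps)
    show "\<bar>(I (x + \<epsilon>) - I x) / \<epsilon> - f x\<bar> \<le> L * \<epsilon>" for x
    proof -
      obtain z where z: "x < z" "z < x + \<epsilon>" "I (x + \<epsilon>) - I x = (x + \<epsilon> - x) * f z"
        using MVT2[of x "x + \<epsilon>" I f] I \<open>\<epsilon> > 0\<close> by auto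
      then have "(I (x + \<epsilon>) - I x) / \<epsilon> = f z" using \<open>\<epsilon> > 0\<close> by simp
      moreover have "\<bar>f z - f x\<bar> \<le> L * \<bar>z - x\<bar>" by (rule lip)
      moreover have "L * \<bar>z - x\<bar> \<le> L * \<epsilon>" using z \<open>0 \<le> L\<close> by (intro mult_left_mono) auto
      ultimately show ?thesis by simp
    qed
  qed
qed

text \<open>
  The difference of the two indicators is the signed indicator of the interval between \<open>x\<close> and \<open>y\<close>,
  which makes the fundamental theorem of calculus hold in either order of the end points.
\<close>

lemma has_bochner_integral_between:
  fixes F :: "real \<Rightarrow> real"
  assumes F: "\<And>x. (F has_real_derivative F' x) (at x)" and F'c: "continuous_on UNIV F'"
  shows "has_bochner_integral lborel (\<lambda>z. F' z * (indicator {x..} z - indicator {y..} z)) (F y - F x)"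
proof -
  have *: "has_bochner_integral lborel (\<lambda>z. F' z * (indicator {x..} z - indicator {y..} z)) (F y - F x)"
    if "x \<le> y" for x y
  proof -
    have [measurable]: "F' \<in> borel_measurable borel"
      by (rule borel_measurable_continuous_onI[OF F'c])
    have "has_bochner_integral lborel (\<lambda>z. F' z * indicator {x..y} z) (F y - F x)"
      using F F'c that
      by (intro has_bochner_integral_FTC_Icc_real) (auto simp: continuous_on_eq_continuous_at)
    then show ?thesis
    proof (rule has_bochner_integral_cong_AE[THEN iffD1, rotated -1])
      show "AE z in lborel. F' z * indicator {x..y} z = F' z * (indicator {x..} z - indicator {y..} z)"
        using AE_lborel_singleton[of y]
      proof eventually_elim
        case (elim z)
        then show ?case using that by (auto simp: indicator_def)
      qed
    qed measurable
  qed
  show ?thesis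
  proof (cases "x \<le> y")
    case False
    have "has_bochner_integral lborel (\<lambda>z. - (F' z * (indicator {y..} z - indicator {x..} z))) (- (F x - F y))"
      using False by (intro has_bochner_integral_minus *) simp
    then show ?thesis by (simp add: algebra_simps)
  qed (rule *)
qed

text \<open>
  Write \<open>F Y - F X\<close> as the integral of \<open>F'\<close> between \<open>X\<close> and \<open>Y\<close> and exchange integral and
  expectation: the expectation of the signed indicator is a difference of distribution functions.
\<close>

lemma smooth_expectation_diff_le:
  fixes X Y :: "'b \<Rightarrow> real"
  assumes "prob_space N"
    and X: "integrable N X" and Y: "integrable N Y"
    and F: "\<And>x. (F has_real_derivative F' x) (at x)" and F'c: "continuous_on UNIV F'"
    and F'b: "\<And>x. \<bar>F' x\<bar> \<le> L"
    and g: "integrable lborel g"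
    and cdf: "\<And>z. \<bar>measure N {\<omega> \<in> space N. Y \<omega> \<le> z} - measure N {\<omega> \<in> space N. X \<omega> \<le> z}\<bar> \<le> g z"
  shows "\<bar>\<integral>\<omega>. F (Y \<omega>) - F (X \<omega>) \<partial>N\<bar> \<le> L * (\<integral>z. g z \<partial>lborel)"
proof -
  interpret N: prob_space N by fact
  interpret NL: pair_sigma_finite N lborel ..
  have [measurable]: "F' \<in> borel_measurable borel"
    by (rule borel_measurable_continuous_onI[OF F'c])
  have [measurable]: "X \<in> borel_measurable N" "Y \<in> borel_measurable N"
    using X Y by auto
  have "0 \<le> L" using F'b[of 0] by linarith
  define k where "k \<omega> z = F' z * (indicator {X \<omega>..} z - indicator {Y \<omega>..} z)" for \<omega> z
  have k_alt: "k \<omega> z = F' z * ((if X \<omega> \<le> z then 1 else 0) - (if Y \<omega> \<le> z then 1 else 0))" for \<omega> z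
    by (simp add: k_def indicator_def)
  have [measurable]: "case_prod k \<in> borel_measurable (N \<Otimes>\<^sub>M lborel)"
    unfolding k_alt by measurable
  have kint: "has_bochner_integral lborel (k \<omega>) (F (Y \<omega>) - F (X \<omega>))" for \<omega>
    unfolding k_def by (rule has_bochner_integral_between[OF F F'c])
  have knorm: "(\<integral>z. norm (k \<omega> z) \<partial>lborel) \<le> L * \<bar>Y \<omega> - X \<omega>\<bar>" for \<omega>
  proof -
    have id: "has_bochner_integral lborel (\<lambda>z. 1 * (indicator {x..} z - indicator {y..} z)) (y - x)"
      for x y :: real
      using has_bochner_integral_between[of "\<lambda>x. x" "\<lambda>_. 1" x y] by auto
    define l u where "l = min (X \<omega>) (Y \<omega>)" and "u = max (X \<omega>) (Y \<omega>)"
    have "(\<integral>z. norm (k \<omega> z) \<partial>lborel) \<le> (\<integral>z. L * (1 * (indicator {l..} z - indicator {u..} z)) \<partial>lborel)"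
    proof (rule integral_mono)
      show "integrable lborel (\<lambda>z. norm (k \<omega> z))"
        using kint by (intro integrable_norm) (auto intro: integrable.intros)
      show "integrable lborel (\<lambda>z. L * (1 * (indicator {l..} z - indicator {u..} z)))"
        using id[of l u] by (intro integrable_mult_right) (auto intro: integrable.intros)
      show "norm (k \<omega> z) \<le> L * (1 * (indicator {l..} z - indicator {u..} z))" for z
        using F'b[of z] \<open>0 \<le> L\<close> by (auto simp: k_def l_def u_def indicator_def)
    qed
    also have "\<dots> = L * (u - l)"
      using has_bochner_integral_integral_eq[OF id[of l u]] by simp
    also have "u - l = \<bar>Y \<omega> - X \<omega>\<bar>" by (auto simp: l_def u_def)
    finally show ?thesis .
  qed
  have kpair: "integrable (N \<Otimes>\<^sub>M lborel) (case_prod k)"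
  proof (rule NL.Fubini_integrable)
    show "integrable N (\<lambda>\<omega>. \<integral>z. norm (case_prod k (\<omega>, z)) \<partial>lborel)"
    proof (rule Bochner_Integration.integrable_bound)
      show "integrable N (\<lambda>\<omega>. L * \<bar>Y \<omega> - X \<omega>\<bar>)" using X Y by auto
      show "AE \<omega> in N. norm (\<integral>z. norm (case_prod k (\<omega>, z)) \<partial>lborel) \<le> norm (L * \<bar>Y \<omega> - X \<omega>\<bar>)"
        using knorm \<open>0 \<le> L\<close> by (intro AE_I2) simp
    qed measurable
    show "AE \<omega> in N. integrable lborel (\<lambda>z. case_prod k (\<omega>, z))"
      using kint by (auto intro: integrable.intros)
  qed measurable
  have "(\<integral>\<omega>. F (Y \<omega>) - F (X \<omega>) \<partial>N) = (\<integral>\<omega>. (\<integral>z. k \<omega> z \<partial>lborel) \<partial>N)"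
    using has_bochner_integral_integral_eq[OF kint] by simp
  also have "\<dots> = (\<integral>z. (\<integral>\<omega>. k \<omega> z \<partial>N) \<partial>lborel)"
    by (rule NL.Fubini_integral[OF kpair, symmetric])
  finally have eq: "(\<integral>\<omega>. F (Y \<omega>) - F (X \<omega>) \<partial>N) = (\<integral>z. (\<integral>\<omega>. k \<omega> z \<partial>N) \<partial>lborel)" .
  have kz: "\<bar>\<integral>\<omega>. k \<omega> z \<partial>N\<bar> \<le> L * g z" for z
  proof -
    have "(\<integral>\<omega>. k \<omega> z \<partial>N) = (\<integral>\<omega>. F' z * (indicator {\<omega> \<in> space N. X \<omega> \<le> z} \<omega> - indicator {\<omega> \<in> space N. Y \<omega> \<le> z} \<omega>) \<partial>N)"
      by (intro Bochner_Integration.integral_cong) (auto simp: k_def indicator_def)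
    also have "\<dots> = F' z * (measure N {\<omega> \<in> space N. X \<omega> \<le> z} - measure N {\<omega> \<in> space N. Y \<omega> \<le> z})"
    proof -
      have *: "(\<integral>\<omega>. c * (indicator A \<omega> - indicator B \<omega>) \<partial>N) = c * (measure N A - measure N B)"
        if "A \<in> sets N" "B \<in> sets N" for A B c
        using that by (simp add: N.emeasure_eq_measure)
      show ?thesis by (rule *) measurable
    qed
    finally have "\<bar>\<integral>\<omega>. k \<omega> z \<partial>N\<bar> = \<bar>F' z\<bar> * \<bar>measure N {\<omega> \<in> space N. Y \<omega> \<le> z} - measure N {\<omega> \<in> space N. X \<omega> \<le> z}\<bar>"
      by (simp add: abs_mult abs_minus_commute)
    also have "\<dots> \<le> L * g z"
      using F'b[of z] cdf[of z] \<open>0 \<le> L\<close> by (intro mult_mono) auto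
    finally show ?thesis .
  qed
  have "\<bar>\<integral>z. (\<integral>\<omega>. k \<omega> z \<partial>N) \<partial>lborel\<bar> \<le> (\<integral>z. L * g z \<partial>lborel)"
  proof -
    have "integrable lborel (\<lambda>z. \<integral>\<omega>. k \<omega> z \<partial>N)"
      using NL.integrable_snd[OF kpair] by simp
    then have "\<bar>\<integral>z. (\<integral>\<omega>. k \<omega> z \<partial>N) \<partial>lborel\<bar> \<le> (\<integral>z. \<bar>\<integral>\<omega>. k \<omega> z \<partial>N\<bar> \<partial>lborel)"
      using integral_norm_bound[of lborel "\<lambda>z. \<integral>\<omega>. k \<omega> z \<partial>N"] by simp
    also have "\<dots> \<le> (\<integral>z. L * g z \<partial>lborel)"
      using kz \<open>integrable lborel (\<lambda>z. \<integral>\<omega>. k \<omega> z \<partial>N)\<close> g by (intro integral_mono) auto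
    finally show ?thesis .
  qed
  then show ?thesis using eq by simp
qed

lemma lipschitz_comp_integrable:
  fixes X :: "'b \<Rightarrow> real"
  assumes "prob_space N" and X: "integrable N X"
    and lip: "\<And>x y. \<bar>f x - f y\<bar> \<le> L * \<bar>x - y\<bar>"
  shows "integrable N (\<lambda>\<omega>. f (X \<omega>) :: real)"
proof -
  interpret prob_space N by fact
  have [measurable]: "f \<in> borel_measurable borel"
    by (rule borel_measurable_continuous_onI[OF lipschitz_real_continuous[OF lip]])
  have [measurable]: "X \<in> borel_measurable N" using X by auto
  have "0 \<le> L" using lip[of 1 0] by simp
  show ?thesis
  proof (rule Bochner_Integration.integrable_bound)
    show "integrable N (\<lambda>\<omega>. \<bar>f 0\<bar> + L * \<bar>X \<omega>\<bar>)" using X by auto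
    have "\<bar>f (X \<omega>)\<bar> \<le> \<bar>f 0\<bar> + L * \<bar>X \<omega>\<bar>" for \<omega>
      using lip[of "X \<omega>" 0] by simp
    then show "AE \<omega> in N. norm (f (X \<omega>)) \<le> norm (\<bar>f 0\<bar> + L * \<bar>X \<omega>\<bar>)"
      using \<open>0 \<le> L\<close> by auto
  qed measurable
qed

text \<open>
  One half of the Kantorovich duality in dimension one: the \<open>L\<^sup>1\<close> distance of distribution functions
  controls the integrals of Lipschitz functions.
\<close>

lemma lipschitz_expectation_diff_le:
  fixes X Y :: "'b \<Rightarrow> real"
  assumes N: "prob_space N"
    and X: "integrable N X" and Y: "integrable N Y"
    and lip: "\<And>x y. \<bar>f x - f y\<bar> \<le> L * \<bar>x - y\<bar>"
    and g: "integrable lborel g"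
    and cdf: "\<And>z. \<bar>measure N {\<omega> \<in> space N. Y \<omega> \<le> z} - measure N {\<omega> \<in> space N. X \<omega> \<le> z}\<bar> \<le> g z"
  shows "\<bar>(\<integral>\<omega>. f (Y \<omega>) \<partial>N) - (\<integral>\<omega>. f (X \<omega>) \<partial>N)\<bar> \<le> L * (\<integral>z. g z \<partial>lborel)"
proof (rule field_le_epsilon)
  interpret prob_space N by fact
  fix r :: real assume "r > 0"
  have "0 \<le> L" using lip[of 1 0] by simp
  define \<epsilon> where "\<epsilon> = r / (2 * (L + 1))"
  have "\<epsilon> > 0" "2 * (L * \<epsilon>) \<le> r"
    using \<open>r > 0\<close> \<open>0 \<le> L\<close> by (auto simp: \<epsilon>_def field_simps)
  obtain F F' where F: "\<And>x. (F has_real_derivative F' x) (at x)" "continuous_on UNIV F'"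
    "\<And>x. \<bar>F' x\<bar> \<le> L" and Ff: "\<And>x. \<bar>F x - f x\<bar> \<le> L * \<epsilon>"
    using lipschitz_smooth_approx[OF lip \<open>\<epsilon> > 0\<close>] by blast
  have Flip: "\<bar>F x - F y\<bar> \<le> L * \<bar>x - y\<bar>" for x y
    using field_differentiable_bound[of UNIV F F' L x y] F(1,3) by (simp add: has_field_derivative_at_within)
  note int = lipschitz_comp_integrable[OF N X lip] lipschitz_comp_integrable[OF N Y lip]
    lipschitz_comp_integrable[OF N X Flip] lipschitz_comp_integrable[OF N Y Flip]
  have close: "\<bar>(\<integral>\<omega>. F (Z \<omega>) \<partial>N) - (\<integral>\<omega>. f (Z \<omega>) \<partial>N)\<bar> \<le> L * \<epsilon>"
    if "integrable N (\<lambda>\<omega>. F (Z \<omega>))" "integrable N (\<lambda>\<omega>. f (Z \<omega>))" for Z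
  proof -
    have "\<bar>\<integral>\<omega>. F (Z \<omega>) - f (Z \<omega>) \<partial>N\<bar> \<le> (\<integral>\<omega>. \<bar>F (Z \<omega>) - f (Z \<omega>)\<bar> \<partial>N)"
      using integral_norm_bound[of N "\<lambda>\<omega>. F (Z \<omega>) - f (Z \<omega>)"] by simp
    also have "\<dots> \<le> L * \<epsilon>"
      using that Ff by (intro integral_le_const) auto
    finally show ?thesis using that by simp
  qed
  have "\<bar>(\<integral>\<omega>. F (Y \<omega>) \<partial>N) - (\<integral>\<omega>. F (X \<omega>) \<partial>N)\<bar> \<le> L * (\<integral>z. g z \<partial>lborel)"
    using smooth_expectation_diff_le[OF N X Y F g cdf] int by simp
  then show "\<bar>(\<integral>\<omega>. f (Y \<omega>) \<partial>N) - (\<integral>\<omega>. f (X \<omega>) \<partial>N)\<bar> \<le> L * (\<integral>z. g z \<partial>lborel) + r"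
    using close[OF int(3,1)] close[OF int(4,2)] \<open>2 * (L * \<epsilon>) \<le> r\<close> by linarith
qed

section \<open>One step of the scheme almost preserves the Gibbs measure\<close>

abbreviation gaussian :: "real \<Rightarrow> real measure" where
  "gaussian \<sigma> \<equiv> density lborel (normal_density 0 \<sigma>)"

lemma cauchy_weight_integrable: "integrable lborel (\<lambda>x::real. 1 / (1 + x\<^sup>2))"
  using Sinc_Integral.integrable_inverse_1_plus_square
  by (simp add: set_integrable_def inverse_eq_divide)

text \<open>
  Decay of order \<open>1 / (1 + z\<^sup>2)\<close> survives a random shift, at the cost of a factor that has finite
  Gaussian moments.
\<close>

lemma cauchy_weight_shift: "1 / (1 + (v + r)\<^sup>2) \<le> 2 * (1 + r\<^sup>2) * (1 / (1 + v\<^sup>2))" for v r :: real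
proof -
  have "1 + v\<^sup>2 \<le> 2 * (1 + r\<^sup>2) * (1 + (v + r)\<^sup>2)"
  proof -
    have "0 \<le> (v + 2 * r)\<^sup>2" by simp
    then have "v\<^sup>2 \<le> 2 * (v + r)\<^sup>2 + 2 * r\<^sup>2" by (simp add: power2_eq_square algebra_simps)
    moreover have "0 \<le> r\<^sup>2 * (v + r)\<^sup>2" by simp
    moreover have "2 * (1 + r\<^sup>2) * (1 + (v + r)\<^sup>2) = 2 + 2 * r\<^sup>2 + 2 * (v + r)\<^sup>2 + 2 * (r\<^sup>2 * (v + r)\<^sup>2)"
      by (simp only: ring_distribs mult_1_left mult_1_right mult.assoc add.assoc)
    ultimately show ?thesis by linarith
  qed
  moreover have "0 < 1 + v\<^sup>2" "0 < 1 + (v + r)\<^sup>2" by (simp_all add: add_pos_nonneg)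
  ultimately show ?thesis by (simp add: field_simps)
qed

lemma cauchy_weight_antimono: "\<bar>z\<bar> \<le> \<bar>u\<bar> \<Longrightarrow> 1 / (1 + u\<^sup>2) \<le> 1 / (1 + z\<^sup>2)" for z u :: real
  by (simp add: abs_le_square_iff frac_le add_pos_nonneg)

text \<open>
  The equation \<open>p' = 2 b p\<close> says that \<open>p\<close> has zero probability flux under \<open>dX = b(X) dt + dW\<close>;
  \<open>q\<close> is the second derivative of \<open>p\<close>. The decay bounds are the ones that the second and third order
  remainders of the distribution function produce.
\<close>

locale gibbs_density = decreasing_drift +
  fixes p q :: "real \<Rightarrow> real" and K :: real
  assumes b_zero: "b 0 = 0"
    and b_abs_mono: "\<And>x y. \<bar>x\<bar> \<le> \<bar>y\<bar> \<Longrightarrow> \<bar>b x\<bar> \<le> \<bar>b y\<bar>"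
    and p_nonneg: "\<And>x. 0 \<le> p x"
    and p_deriv: "\<And>x. (p has_real_derivative 2 * b x * p x) (at x)"
    and p_deriv2: "\<And>x. ((\<lambda>x. 2 * b x * p x) has_real_derivative q x) (at x)"
    and p_prob: "prob_space (density lborel p)"
    and p_mean: "integrable (density lborel p) (\<lambda>x. x)"
    and q_decay: "\<And>x. \<bar>q x\<bar> \<le> K * (1 / (1 + x\<^sup>2))"
    and bq_decay: "\<And>x. \<bar>b x\<bar> * \<bar>q x\<bar> \<le> K * (1 / (1 + x\<^sup>2))"
    and bbbp_decay: "\<And>x. \<bar>b x\<bar> ^ 3 * p x \<le> K * (1 / (1 + x\<^sup>2))"
begin

abbreviation gibbs :: "real measure" where "gibbs \<equiv> density lborel p"

sublocale gibbs: prob_space gibbs by (rule p_prob)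

lemma K_nonneg: "0 \<le> K"
  using q_decay[of 0] by simp

lemma p_cont: "continuous_on A p"
  using p_deriv DERIV_isCont by (intro continuous_at_imp_continuous_on) blast

lemma p_measurable[measurable]: "p \<in> borel_measurable borel"
  by (rule borel_measurable_continuous_onI[OF p_cont])

definition distr_fun :: "real \<Rightarrow> real" where "distr_fun u = measure gibbs {..u}"

lemma distr_fun_deriv: "(distr_fun has_real_derivative p u) (at u)"
proof -
  obtain P where P: "\<And>x. (P has_real_derivative p x) (at x)"
    using antiderivative_real[OF p_cont] by auto
  have inc: "distr_fun y - distr_fun x = P y - P x" if "x \<le> y" for x y
  proof -
    have "emeasure gibbs {x<..y} = (\<integral>\<^sup>+z. ennreal (p z) * indicator {x<..y} z \<partial>lborel)"
      by (rule emeasure_density) auto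
    also have "\<dots> = (\<integral>\<^sup>+z. ennreal (p z) * indicator {x..y} z \<partial>lborel)"
    proof (rule nn_integral_cong_AE)
      show "AE z in lborel. ennreal (p z) * indicator {x<..y} z = ennreal (p z) * indicator {x..y} z"
        using AE_lborel_singleton[of x]
      proof eventually_elim
        case (elim z)
        then show ?case by (auto simp: indicator_def)
      qed
    qed
    also have "\<dots> = ennreal (P y - P x)"
      by (rule nn_integral_FTC_Icc) (use P that p_nonneg in auto)
    finally have "measure gibbs {x<..y} = P y - P x"
      using that DERIV_nonneg_imp_nondecreasing[of x y P] P p_nonneg
      by (simp add: measure_def) (metis diff_ge_0_iff_ge enn2real_ennreal)
    moreover have "distr_fun y = distr_fun x + measure gibbs {x<..y}"
    proof -
      have "{..y} = {..x} \<union> {x<..y}" using that by auto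
      moreover have "measure gibbs ({..x} \<union> {x<..y}) = measure gibbs {..x} + measure gibbs {x<..y}"
        by (rule gibbs.finite_measure_Union) auto
      ultimately show ?thesis by (simp only: distr_fun_def)
    qed
    ultimately show ?thesis by simp
  qed
  have "distr_fun = (\<lambda>x. P x + (distr_fun 0 - P 0))"
  proof
    fix x
    show "distr_fun x = P x + (distr_fun 0 - P 0)"
      using inc[of 0 x] inc[of x 0] by (cases "0 \<le> x") auto
  qed
  moreover have "((\<lambda>x. P x + (distr_fun 0 - P 0)) has_real_derivative p u) (at u)"
    using P[of u] by (auto intro!: derivative_eq_intros)
  ultimately show ?thesis by simp
qed

lemma distr_fun_cont: "continuous_on A distr_fun"
  using distr_fun_deriv DERIV_isCont by (intro continuous_at_imp_continuous_on) blast

lemma distr_fun_measurable[measurable]: "distr_fun \<in> borel_measurable borel"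
  by (rule borel_measurable_continuous_onI[OF distr_fun_cont])

lemma distr_fun_bounds: "0 \<le> distr_fun u" "distr_fun u \<le> 1"
  by (auto simp: distr_fun_def)

lemma distr_fun_taylor2:
  "\<exists>t. min u v \<le> t \<and> t \<le> max u v \<and>
     distr_fun v = distr_fun u + p u * (v - u) + b t * p t * (v - u)\<^sup>2"
proof (cases "u = v")
  case False
  define D where "D = (\<lambda>k::nat. if k = 0 then distr_fun else if k = 1 then p else (\<lambda>x. 2 * b x * p x))"
  have "\<exists>t. (if v < u then v < t \<and> t < u else u < t \<and> t < v) \<and>
    distr_fun v = (\<Sum>m<2. D m u / fact m * (v - u) ^ m) + D 2 t / fact 2 * (v - u) ^ 2"
    by (rule Taylor[where a = "min u v" and b = "max u v"])
       (use False distr_fun_deriv p_deriv in \<open>auto simp: D_def less_2_cases_iff\<close>)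
  then obtain t where "if v < u then v < t \<and> t < u else u < t \<and> t < v"
    "distr_fun v = (\<Sum>m<2. D m u / fact m * (v - u) ^ m) + D 2 t / fact 2 * (v - u) ^ 2" by blast
  then show ?thesis
    by (intro exI[of _ t]) (auto simp: D_def numeral_2_eq_2 split: if_splits)
qed (auto intro!: exI[of _ u])

lemma distr_fun_taylor3:
  "\<exists>t. min u v \<le> t \<and> t \<le> max u v \<and>
     distr_fun v = distr_fun u + p u * (v - u) + b u * p u * (v - u)\<^sup>2 + q t / 6 * (v - u) ^ 3"
proof (cases "u = v")
  case False
  define D where "D = (\<lambda>k::nat. if k = 0 then distr_fun else if k = 1 then p
    else if k = 2 then (\<lambda>x. 2 * b x * p x) else q)"
  have "\<exists>t. (if v < u then v < t \<and> t < u else u < t \<and> t < v) \<and>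
    distr_fun v = (\<Sum>m<3. D m u / fact m * (v - u) ^ m) + D 3 t / fact 3 * (v - u) ^ 3"
  proof (rule Taylor[where a = "min u v" and b = "max u v"])
    show "\<forall>m t. m < 3 \<and> min u v \<le> t \<and> t \<le> max u v \<longrightarrow> (D m has_real_derivative D (Suc m) t) (at t)"
    proof safe
      fix m t assume "m < (3::nat)"
      then consider "m = 0" | "m = 1" | "m = 2" by linarith
      then show "(D m has_real_derivative D (Suc m) t) (at t)"
        by cases (use distr_fun_deriv p_deriv p_deriv2 in \<open>auto simp: D_def\<close>)
    qed
  qed (use False in \<open>auto simp: D_def\<close>)
  then obtain t where "if v < u then v < t \<and> t < u else u < t \<and> t < v"
    "distr_fun v = (\<Sum>m<3. D m u / fact m * (v - u) ^ m) + D 3 t / fact 3 * (v - u) ^ 3" by blast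
  then show ?thesis
    by (intro exI[of _ t]) (auto simp: D_def numeral_3_eq_3 numeral_2_eq_2 fact_numeral split: if_splits)
qed (auto intro!: exI[of _ u])

text \<open>
  Taylor expansion to third order: the first Gaussian moment vanishes, the second one produces
  \<open>\<sigma>\<^sup>2 p' / 2 = \<sigma>\<^sup>2 b p\<close>, and the third one the error.
\<close>

lemma gaussian_smoothing_error:
  assumes "0 < \<sigma>" "\<sigma> \<le> 1"
  shows "\<bar>(\<integral>y. distr_fun (v - y) \<partial>gaussian \<sigma>) - distr_fun v - \<sigma>\<^sup>2 * (b v * p v)\<bar>
     \<le> 4 * K * \<sigma> ^ 3 * (1 / (1 + v\<^sup>2))"
proof -
  interpret G: prob_space "gaussian \<sigma>" by (rule prob_space_normal_density) fact
  define w where "w = 1 / (1 + v\<^sup>2)"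
  have "w \<ge> 0" by (simp add: w_def)
  define T where "T y = distr_fun v - p v * y + b v * p v * y\<^sup>2" for y
  have pointwise: "\<bar>distr_fun (v - y) - T y\<bar> \<le> K / 3 * w * (\<bar>y\<bar> ^ 3 + \<bar>y\<bar> ^ 5)" for y
  proof -
    obtain t where t: "min v (v - y) \<le> t" "t \<le> max v (v - y)"
      and eq: "distr_fun (v - y) = distr_fun v + p v * (v - y - v) + b v * p v * (v - y - v)\<^sup>2
        + q t / 6 * (v - y - v) ^ 3"
      using distr_fun_taylor3[of v "v - y"] by blast
    define r where "r = t - v"
    have r: "\<bar>r\<bar> \<le> \<bar>y\<bar>" using t by (auto simp: r_def)
    have "\<bar>q t\<bar> \<le> K * (1 / (1 + (v + r)\<^sup>2))" using q_decay[of t] by (simp add: r_def)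
    also have "\<dots> \<le> K * (2 * (1 + r\<^sup>2) * w)"
      using cauchy_weight_shift K_nonneg unfolding w_def by (rule mult_left_mono)
    also have "\<dots> \<le> K * (2 * (1 + y\<^sup>2) * w)"
      using r K_nonneg \<open>w \<ge> 0\<close> by (intro mult_left_mono mult_right_mono add_mono) (auto simp: abs_le_square_iff)
    finally have qt: "\<bar>q t\<bar> \<le> K * (2 * (1 + y\<^sup>2) * w)" .
    have "\<bar>distr_fun (v - y) - T y\<bar> = \<bar>q t\<bar> / 6 * \<bar>y\<bar> ^ 3"
      using eq by (simp add: T_def abs_mult power_abs)
    also have "\<dots> \<le> (K * (2 * (1 + y\<^sup>2) * w)) / 6 * \<bar>y\<bar> ^ 3"
      using qt by (intro mult_right_mono divide_right_mono) auto
    also have "\<dots> = K / 3 * w * (\<bar>y\<bar> ^ 3 + \<bar>y\<bar> ^ 5)"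
    proof -
      have "\<bar>y\<bar> ^ 5 = \<bar>y\<bar>\<^sup>2 * \<bar>y\<bar> ^ 3" by (simp only: power_add[symmetric]) simp
      then have "\<bar>y\<bar> ^ 5 = y\<^sup>2 * \<bar>y\<bar> ^ 3" by simp
      then show ?thesis by (simp add: algebra_simps)
    qed
    finally show ?thesis .
  qed
  have mom: "has_bochner_integral (gaussian \<sigma>) f c"
    if "has_bochner_integral lborel (\<lambda>x. normal_density 0 \<sigma> x * f x) c" "f \<in> borel_measurable borel"
    for f :: "real \<Rightarrow> real" and c
    using that by (intro has_bochner_integral_density) auto
  have m1: "has_bochner_integral (gaussian \<sigma>) (\<lambda>y. y) 0"
    using normal_moment_odd[OF \<open>0 < \<sigma>\<close>, of 0 0] by (intro mom) auto
  have m2: "has_bochner_integral (gaussian \<sigma>) (\<lambda>y. y\<^sup>2) (\<sigma>\<^sup>2)"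
    using normal_moment_even[OF \<open>0 < \<sigma>\<close>, of 0 1] by (intro mom) (auto simp: fact_numeral)
  have m3: "has_bochner_integral (gaussian \<sigma>) (\<lambda>y. \<bar>y\<bar> ^ 3) (2 * \<sigma> ^ 3 * sqrt (2 / pi))"
    using normal_moment_abs_odd[OF \<open>0 < \<sigma>\<close>, of 0 1] by (intro mom) (auto simp: fact_numeral numeral_3_eq_3)
  have m5: "has_bochner_integral (gaussian \<sigma>) (\<lambda>y. \<bar>y\<bar> ^ 5) (8 * \<sigma> ^ 5 * sqrt (2 / pi))"
    using normal_moment_abs_odd[OF \<open>0 < \<sigma>\<close>, of 0 2] by (intro mom) (auto simp: fact_numeral)
  have mT: "has_bochner_integral (gaussian \<sigma>) T (distr_fun v - p v * 0 + b v * p v * \<sigma>\<^sup>2)"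
    unfolding T_def
    by (intro has_bochner_integral_add has_bochner_integral_diff has_bochner_integral_mult_right m1 m2)
       (use G.prob_space in \<open>simp add: has_bochner_integral_iff\<close>)
  have mB: "has_bochner_integral (gaussian \<sigma>) (\<lambda>y. K / 3 * w * (\<bar>y\<bar> ^ 3 + \<bar>y\<bar> ^ 5))
      (K / 3 * w * (2 * \<sigma> ^ 3 * sqrt (2 / pi) + 8 * \<sigma> ^ 5 * sqrt (2 / pi)))"
    by (intro has_bochner_integral_mult_right has_bochner_integral_add m3 m5)
  have mF: "integrable (gaussian \<sigma>) (\<lambda>y. distr_fun (v - y))"
    by (rule G.integrable_const_bound[where B = 1]) (use distr_fun_bounds in auto)
  have "(\<integral>y. distr_fun (v - y) \<partial>gaussian \<sigma>) - distr_fun v - \<sigma>\<^sup>2 * (b v * p v)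
      = (\<integral>y. distr_fun (v - y) \<partial>gaussian \<sigma>) - (\<integral>y. T y \<partial>gaussian \<sigma>)"
    using has_bochner_integral_integral_eq[OF mT] by simp
  also have "\<dots> = (\<integral>y. distr_fun (v - y) - T y \<partial>gaussian \<sigma>)"
    using mF mT by (intro Bochner_Integration.integral_diff[symmetric]) (auto simp: has_bochner_integral_iff)
  finally have "\<bar>(\<integral>y. distr_fun (v - y) \<partial>gaussian \<sigma>) - distr_fun v - \<sigma>\<^sup>2 * (b v * p v)\<bar>
      = \<bar>\<integral>y. distr_fun (v - y) - T y \<partial>gaussian \<sigma>\<bar>" by simp
  also have "\<dots> \<le> (\<integral>y. \<bar>distr_fun (v - y) - T y\<bar> \<partial>gaussian \<sigma>)"
    using integral_norm_bound[of "gaussian \<sigma>" "\<lambda>y. distr_fun (v - y) - T y"] by simp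
  also have "\<dots> \<le> (\<integral>y. K / 3 * w * (\<bar>y\<bar> ^ 3 + \<bar>y\<bar> ^ 5) \<partial>gaussian \<sigma>)"
    by (intro integral_mono integrable_abs Bochner_Integration.integrable_diff mF pointwise)
       (use mT mB in \<open>auto simp: has_bochner_integral_iff\<close>)
  also have "\<dots> = K / 3 * w * (sqrt (2 / pi) * (2 * \<sigma> ^ 3 + 8 * \<sigma> ^ 5))"
    using has_bochner_integral_integral_eq[OF mB] by (simp add: algebra_simps)
  \<comment> \<open>the third and fifth absolute moments contribute \<open>2 + 8\<close>, and \<open>10 / 3 \<le> 4\<close>\<close>
  also have "\<dots> \<le> K / 3 * w * (1 * (10 * \<sigma> ^ 3))"
  proof (intro mult_left_mono mult_mono)
    show "sqrt (2 / pi) \<le> 1" using pi_gt3 by (simp add: field_simps)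
    have "\<sigma> ^ 5 \<le> \<sigma> ^ 3" using assms by (intro power_decreasing) auto
    then show "2 * \<sigma> ^ 3 + 8 * \<sigma> ^ 5 \<le> 10 * \<sigma> ^ 3" by simp
  qed (use K_nonneg \<open>w \<ge> 0\<close> assms in auto)
  also have "\<dots> \<le> 4 * K * \<sigma> ^ 3 * w"
  proof -
    have "0 \<le> K * w * \<sigma> ^ 3" using K_nonneg \<open>w \<ge> 0\<close> assms by simp
    then show ?thesis by (simp add: algebra_simps)
  qed
  finally show ?thesis unfolding w_def .
qed

text \<open>
  The point \<open>z - d b z\<close> lies further from the origin than \<open>z\<close>, because \<open>b z\<close> points towards the
  origin. All intermediate points of the Taylor formulas are therefore at least as far out as \<open>z\<close>,
  so that the decay bounds there are at least as good as at \<open>z\<close>, however fast \<open>b\<close> grows.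
\<close>

lemma transport_error:
  assumes "0 \<le> d"
  shows "\<bar>distr_fun (z - d * b z) - distr_fun z + d * (b (z - d * b z) * p (z - d * b z))\<bar>
     \<le> 2 * K * d\<^sup>2 * (1 / (1 + z\<^sup>2))"
proof -
  define v where "v = z - d * b z"
  define w where "w = 1 / (1 + z\<^sup>2)"
  have outward: "\<bar>z\<bar> \<le> \<bar>t\<bar>" if "min z v \<le> t" "t \<le> max z v" for t
  proof (cases "0 \<le> z")
    case True
    then have "d * b z \<le> 0" using b_antimono[of 0 z] b_zero assms by (simp add: mult_nonneg_nonpos)
    then show ?thesis using that True by (simp add: v_def)
  next
    case False
    then have "0 \<le> d * b z" using b_antimono[of z 0] b_zero assms by simp
    then show ?thesis using that False by (simp add: v_def)
  qed
  obtain t where t: "min z v \<le> t" "t \<le> max z v"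
    and Ft: "distr_fun v = distr_fun z + p z * (v - z) + b t * p t * (v - z)\<^sup>2"
    using distr_fun_taylor2[of z v] by blast
  have "\<exists>s. min z v \<le> s \<and> s \<le> max z v \<and> 2 * b v * p v - 2 * b z * p z = (v - z) * q s"
  proof (cases z v rule: linorder_cases)
    case less
    then obtain s where "z < s" "s < v" "2 * b v * p v - 2 * b z * p z = (v - z) * q s"
      using MVT2[OF less, of "\<lambda>x. 2 * b x * p x" q] p_deriv2 by blast
    then show ?thesis by (intro exI[of _ s]) auto
  next
    case greater
    then obtain s where "v < s" "s < z" "2 * b z * p z - 2 * b v * p v = (z - v) * q s"
      using MVT2[OF greater, of "\<lambda>x. 2 * b x * p x" q] p_deriv2 by blast
    then show ?thesis by (intro exI[of _ s]) (auto simp: algebra_simps)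
  qed (auto intro!: exI[of _ z])
  then obtain s where s: "min z v \<le> s" "s \<le> max z v" and qs: "2 * b v * p v - 2 * b z * p z = (v - z) * q s"
    by blast
  have vz: "v - z = - (d * b z)" by (simp add: v_def)
  have bv: "b v * p v = b z * p z - d * b z * q s / 2" using qs vz by (simp add: algebra_simps)
  have "distr_fun v - distr_fun z + d * (b v * p v) = d\<^sup>2 * (b t * p t * (b z)\<^sup>2 - b z * q s / 2)"
    unfolding Ft vz bv by (simp add: power2_eq_square algebra_simps)
  also have "\<bar>\<dots>\<bar> \<le> d\<^sup>2 * (2 * K * w)"
  proof -
    have "\<bar>b t * p t * (b z)\<^sup>2\<bar> \<le> K * w"
    proof -
      have "\<bar>b t * p t * (b z)\<^sup>2\<bar> = \<bar>b t\<bar> * p t * \<bar>b z\<bar>\<^sup>2" using p_nonneg by (simp add: abs_mult)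
      also have "\<dots> \<le> \<bar>b t\<bar> * p t * \<bar>b t\<bar>\<^sup>2"
        using p_nonneg b_abs_mono[OF outward[OF t]] by (intro mult_left_mono power_mono) auto
      also have "\<dots> = \<bar>b t\<bar> ^ 3 * p t" by (simp add: power3_eq_cube power2_eq_square)
      also have "\<dots> \<le> K * w"
        unfolding w_def using bbbp_decay[of t] cauchy_weight_antimono[OF outward[OF t]] K_nonneg
        by (meson mult_left_mono order_trans)
      finally show ?thesis .
    qed
    moreover have "\<bar>b z * q s / 2\<bar> \<le> K * w"
    proof -
      have "\<bar>b z * q s / 2\<bar> \<le> \<bar>b z\<bar> * \<bar>q s\<bar>" by (simp add: abs_mult)
      also have "\<dots> \<le> \<bar>b s\<bar> * \<bar>q s\<bar>"
        using b_abs_mono[OF outward[OF s]] by (intro mult_right_mono) auto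
      also have "\<dots> \<le> K * w"
        unfolding w_def using bq_decay[of s] cauchy_weight_antimono[OF outward[OF s]] K_nonneg
        by (meson mult_left_mono order_trans)
      finally show ?thesis .
    qed
    ultimately have "\<bar>b t * p t * (b z)\<^sup>2 - b z * q s / 2\<bar> \<le> 2 * K * w" by linarith
    then show ?thesis by (simp add: abs_mult mult_left_mono)
  qed
  finally show ?thesis unfolding v_def w_def by (simp add: mult_ac)
qed

text \<open>
  The term \<open>\<sigma>\<^sup>2 b p\<close> gained by smoothing is the one lost by transport; both are evaluated at the
  transported point, so they cancel exactly.
\<close>

lemma one_step_distr_fun:
  assumes "0 < \<sigma>" "\<sigma> \<le> 1"
  shows "\<bar>(\<integral>y. distr_fun (z - \<sigma>\<^sup>2 * b z - y) \<partial>gaussian \<sigma>) - distr_fun z\<bar>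
     \<le> 6 * K * \<sigma> ^ 3 * (1 / (1 + z\<^sup>2))"
proof -
  define v where "v = z - \<sigma>\<^sup>2 * b z"
  have "\<bar>z\<bar> \<le> \<bar>v\<bar>"
    using implicit_step_expanding[of "\<sigma>\<^sup>2" z 0] by (simp add: v_def b_zero)
  then have w: "1 / (1 + v\<^sup>2) \<le> 1 / (1 + z\<^sup>2)" by (rule cauchy_weight_antimono)
  have "4 * K * \<sigma> ^ 3 * (1 / (1 + v\<^sup>2)) \<le> 4 * K * \<sigma> ^ 3 * (1 / (1 + z\<^sup>2))"
    using K_nonneg assms by (intro mult_left_mono w) auto
  moreover have "2 * K * (\<sigma>\<^sup>2)\<^sup>2 * (1 / (1 + z\<^sup>2)) \<le> 2 * K * \<sigma> ^ 3 * (1 / (1 + z\<^sup>2))"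
  proof -
    have "(\<sigma>\<^sup>2)\<^sup>2 \<le> \<sigma> ^ 3"
      using assms power_decreasing[of 3 4 \<sigma>] by (simp flip: power_mult)
    then show ?thesis using K_nonneg by (intro mult_right_mono mult_left_mono) auto
  qed
  moreover note gaussian_smoothing_error[OF assms, of v] transport_error[OF zero_le_power2, of z \<sigma>, folded v_def]
  ultimately show ?thesis unfolding v_def[symmetric] by linarith
qed

text \<open>The transition operator of one step of length \<open>\<sigma>\<^sup>2\<close>.\<close>

definition euler_kernel :: "real \<Rightarrow> (real \<Rightarrow> real) \<Rightarrow> real \<Rightarrow> real" where
  "euler_kernel \<sigma> f x = (\<integral>y. f (resolvent (\<sigma>\<^sup>2) (x + y)) \<partial>gaussian \<sigma>)"

lemma euler_kernel_lipschitz: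
  assumes "0 < \<sigma>" and lip: "\<And>x y. \<bar>f x - f y\<bar> \<le> L * \<bar>x - y\<bar>" and bnd: "\<And>x. \<bar>f x\<bar> \<le> B"
  shows "\<bar>euler_kernel \<sigma> f x - euler_kernel \<sigma> f y\<bar> \<le> L * \<bar>x - y\<bar>"
    and "\<bar>euler_kernel \<sigma> f x\<bar> \<le> B"
proof -
  interpret G: prob_space "gaussian \<sigma>" by (rule prob_space_normal_density) fact
  have [measurable]: "f \<in> borel_measurable borel"
    by (rule borel_measurable_continuous_onI[OF lipschitz_real_continuous[OF lip]])
  have [measurable]: "resolvent (\<sigma>\<^sup>2) \<in> borel_measurable borel" by simp
  have "0 \<le> L" using lip[of 1 0] by simp
  have int: "integrable (gaussian \<sigma>) (\<lambda>y. f (resolvent (\<sigma>\<^sup>2) (x + y)))" for x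
    by (rule G.integrable_const_bound[where B = B]) (use bnd in auto)
  have "\<bar>euler_kernel \<sigma> f x - euler_kernel \<sigma> f y\<bar>
      = \<bar>\<integral>u. f (resolvent (\<sigma>\<^sup>2) (x + u)) - f (resolvent (\<sigma>\<^sup>2) (y + u)) \<partial>gaussian \<sigma>\<bar>"
    unfolding euler_kernel_def using int by simp
  also have "\<dots> \<le> (\<integral>u. \<bar>f (resolvent (\<sigma>\<^sup>2) (x + u)) - f (resolvent (\<sigma>\<^sup>2) (y + u))\<bar> \<partial>gaussian \<sigma>)"
    using integral_norm_bound[of "gaussian \<sigma>"
        "\<lambda>u. f (resolvent (\<sigma>\<^sup>2) (x + u)) - f (resolvent (\<sigma>\<^sup>2) (y + u))"] by simp
  also have "\<dots> \<le> L * \<bar>x - y\<bar>"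
  proof (rule G.integral_le_const)
    have "\<bar>f (resolvent (\<sigma>\<^sup>2) (x + u)) - f (resolvent (\<sigma>\<^sup>2) (y + u))\<bar> \<le> L * \<bar>x - y\<bar>" for u
      using lip[of "resolvent (\<sigma>\<^sup>2) (x + u)" "resolvent (\<sigma>\<^sup>2) (y + u)"]
        mult_left_mono[OF resolvent_contraction[of "\<sigma>\<^sup>2" "x + u" "y + u"] \<open>0 \<le> L\<close>] by simp
    then show "AE u in gaussian \<sigma>. \<bar>f (resolvent (\<sigma>\<^sup>2) (x + u)) - f (resolvent (\<sigma>\<^sup>2) (y + u))\<bar> \<le> L * \<bar>x - y\<bar>"
      by auto
  qed (use int in auto)
  finally show "\<bar>euler_kernel \<sigma> f x - euler_kernel \<sigma> f y\<bar> \<le> L * \<bar>x - y\<bar>" .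
  have "\<bar>euler_kernel \<sigma> f x\<bar> \<le> (\<integral>u. \<bar>f (resolvent (\<sigma>\<^sup>2) (x + u))\<bar> \<partial>gaussian \<sigma>)"
    unfolding euler_kernel_def
    using integral_norm_bound[of "gaussian \<sigma>" "\<lambda>u. f (resolvent (\<sigma>\<^sup>2) (x + u))"] by simp
  also have "\<dots> \<le> B" by (rule G.integral_le_const) (use int bnd in auto)
  finally show "\<bar>euler_kernel \<sigma> f x\<bar> \<le> B" .
qed

text \<open>
  Realise the law before and after the step on the same probability space, as the first coordinate
  of \<open>gibbs \<Otimes>\<^sub>M gaussian \<sigma>\<close> and its image, and compare their distribution functions.
\<close>

lemma one_step_error:
  assumes \<sigma>: "0 < \<sigma>" "\<sigma> \<le> 1"
    and lip: "\<And>x y. \<bar>f x - f y\<bar> \<le> L * \<bar>x - y\<bar>" and bnd: "\<And>x. \<bar>f x\<bar> \<le> B"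
  shows "\<bar>(\<integral>x. euler_kernel \<sigma> f x \<partial>gibbs) - (\<integral>x. f x \<partial>gibbs)\<bar>
     \<le> L * (6 * K * \<sigma> ^ 3 * (\<integral>z. 1 / (1 + z\<^sup>2) \<partial>lborel))"
proof -
  interpret G: prob_space "gaussian \<sigma>" by (rule prob_space_normal_density) fact
  interpret GG: pair_prob_space gibbs "gaussian \<sigma>" ..
  have [measurable]: "f \<in> borel_measurable borel"
    by (rule borel_measurable_continuous_onI[OF lipschitz_real_continuous[OF lip]])
  have R[measurable]: "resolvent (\<sigma>\<^sup>2) \<in> borel_measurable borel" by simp
  define N where "N = gibbs \<Otimes>\<^sub>M gaussian \<sigma>"
  define Y where "Y = (\<lambda>(x, y). resolvent (\<sigma>\<^sup>2) (x + y))"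
  have sp: "space N = UNIV" by (simp add: N_def space_pair_measure)
  have [measurable_cong]: "sets N = sets (borel \<Otimes>\<^sub>M borel)"
    unfolding N_def by (intro sets_pair_measure_cong) auto
  have [measurable]: "Y \<in> borel_measurable N" unfolding Y_def by measurable
  have N: "prob_space N" unfolding N_def by (rule prob_space_pair[OF p_prob G.prob_space_axioms])
  have fst_int: "integrable N fst"
    unfolding N_def using p_mean
    by (intro GG.Fubini_integrable) (auto simp: G.prob_space)
  have "integrable (gaussian \<sigma>) (\<lambda>y. y)"
    using integrable_normal_moment[OF \<open>0 < \<sigma>\<close>, of 0 1] by (simp add: integrable_density)
  then have snd_int: "integrable N snd"
    unfolding N_def by (intro GG.Fubini_integrable) (auto simp: gibbs.prob_space)
  have resolvent_abs: "\<bar>resolvent (\<sigma>\<^sup>2) u\<bar> \<le> \<bar>u\<bar>" for u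
    using resolvent_contraction[of "\<sigma>\<^sup>2" u 0] resolvent_unique[of "\<sigma>\<^sup>2" 0 0] b_zero by simp
  have Y_int: "integrable N Y"
  proof (rule Bochner_Integration.integrable_bound)
    show "integrable N (\<lambda>\<omega>. \<bar>fst \<omega>\<bar> + \<bar>snd \<omega>\<bar>)" using fst_int snd_int by auto
    show "AE \<omega> in N. norm (Y \<omega>) \<le> norm (\<bar>fst \<omega>\<bar> + \<bar>snd \<omega>\<bar>)"
    proof (rule AE_I2)
      fix \<omega>
      show "norm (Y \<omega>) \<le> norm (\<bar>fst \<omega>\<bar> + \<bar>snd \<omega>\<bar>)"
        using resolvent_abs[of "fst \<omega> + snd \<omega>"] by (auto simp: Y_def split: prod.split)
    qed
  qed measurable
  have cdf_fst: "measure N {\<omega> \<in> space N. fst \<omega> \<le> z} = distr_fun z" for z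
  proof -
    have "{\<omega> \<in> space N. fst \<omega> \<le> z} = {..z} \<times> UNIV" by (auto simp: sp)
    then show ?thesis
      using G.emeasure_space_1
      by (simp add: N_def distr_fun_def measure_def G.emeasure_pair_measure_Times)
  qed
  have cdf_Y: "measure N {\<omega> \<in> space N. Y \<omega> \<le> z} = (\<integral>y. distr_fun (z - \<sigma>\<^sup>2 * b z - y) \<partial>gaussian \<sigma>)" for z
  proof -
    define v where "v = z - \<sigma>\<^sup>2 * b z"
    have set_eq: "{\<omega> \<in> space N. Y \<omega> \<le> z} = {\<omega> \<in> space N. fst \<omega> + snd \<omega> \<le> v}"
      by (auto simp: Y_def resolvent_le_iff v_def split: prod.split)
    have "emeasure N {\<omega> \<in> space N. Y \<omega> \<le> z} = emeasure N {\<omega> \<in> space N. fst \<omega> + snd \<omega> \<le> v}"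
      unfolding set_eq ..
    also have "\<dots> = (\<integral>\<^sup>+y. emeasure gibbs ((\<lambda>x. (x, y)) -` {\<omega> \<in> space N. fst \<omega> + snd \<omega> \<le> v}) \<partial>gaussian \<sigma>)"
    proof -
      have "{\<omega> \<in> space N. fst \<omega> + snd \<omega> \<le> v} \<in> sets N" by measurable
      then show ?thesis unfolding N_def by (rule GG.emeasure_pair_measure_alt2)
    qed
    also have "\<dots> = (\<integral>\<^sup>+y. ennreal (distr_fun (v - y)) \<partial>gaussian \<sigma>)"
    proof (rule nn_integral_cong)
      fix y
      have "(\<lambda>x. (x, y)) -` {\<omega> \<in> space N. fst \<omega> + snd \<omega> \<le> v} = {..v - y}"
        by (auto simp: sp)
      then show "emeasure gibbs ((\<lambda>x. (x, y)) -` {\<omega> \<in> space N. fst \<omega> + snd \<omega> \<le> v}) = ennreal (distr_fun (v - y))"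
        by (simp add: distr_fun_def gibbs.emeasure_eq_measure)
    qed
    also have "\<dots> = ennreal (\<integral>y. distr_fun (v - y) \<partial>gaussian \<sigma>)"
    proof (rule nn_integral_eq_integral)
      show "integrable (gaussian \<sigma>) (\<lambda>y. distr_fun (v - y))"
        by (rule G.integrable_const_bound[where B = 1]) (use distr_fun_bounds in auto)
    qed (use distr_fun_bounds in auto)
    finally show ?thesis
      using distr_fun_bounds by (simp add: measure_def v_def)
  qed
  have "\<bar>(\<integral>\<omega>. f (Y \<omega>) \<partial>N) - (\<integral>\<omega>. f (fst \<omega>) \<partial>N)\<bar>
      \<le> L * (\<integral>z. 6 * K * \<sigma> ^ 3 * (1 / (1 + z\<^sup>2)) \<partial>lborel)"
  proof (rule lipschitz_expectation_diff_le[OF N fst_int Y_int lip])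
    show "integrable lborel (\<lambda>z. 6 * K * \<sigma> ^ 3 * (1 / (1 + z\<^sup>2)))"
      by (intro integrable_mult_right cauchy_weight_integrable)
  qed (unfold cdf_fst cdf_Y, rule one_step_distr_fun[OF \<sigma>])
  moreover have "(\<integral>\<omega>. f (fst \<omega>) \<partial>N) = (\<integral>x. f x \<partial>gibbs)"
  proof -
    have "integrable N (\<lambda>\<omega>. f (fst \<omega>))" by (rule lipschitz_comp_integrable[OF N fst_int lip])
    then show ?thesis using G.prob_space unfolding N_def by (subst GG.integral_fst'[symmetric]) auto
  qed
  moreover have "(\<integral>\<omega>. f (Y \<omega>) \<partial>N) = (\<integral>x. euler_kernel \<sigma> f x \<partial>gibbs)"
  proof -
    have "integrable N (\<lambda>\<omega>. f (Y \<omega>))" by (rule lipschitz_comp_integrable[OF N Y_int lip])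
    then show ?thesis
      unfolding N_def by (subst GG.integral_fst'[symmetric]) (auto simp: Y_def euler_kernel_def[abs_def])
  qed
  moreover have "(\<integral>z. 6 * K * \<sigma> ^ 3 * (1 / (1 + z\<^sup>2)) \<partial>lborel)
      = 6 * K * \<sigma> ^ 3 * (\<integral>z. 1 / (1 + z\<^sup>2) \<partial>lborel)"
    by (rule integral_mult_right_zero)
  ultimately show ?thesis by (simp only:)
qed

lemma funpow_euler_kernel_regular:
  assumes "0 < \<sigma>" and lip: "\<And>x y. \<bar>f x - f y\<bar> \<le> L * \<bar>x - y\<bar>" and bnd: "\<And>x. \<bar>f x\<bar> \<le> B"
  shows "\<bar>(euler_kernel \<sigma> ^^ n) f x - (euler_kernel \<sigma> ^^ n) f y\<bar> \<le> L * \<bar>x - y\<bar>"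
    and "\<bar>(euler_kernel \<sigma> ^^ n) f x\<bar> \<le> B"
proof -
  have "(\<forall>x y. \<bar>(euler_kernel \<sigma> ^^ n) f x - (euler_kernel \<sigma> ^^ n) f y\<bar> \<le> L * \<bar>x - y\<bar>) \<and>
      (\<forall>x. \<bar>(euler_kernel \<sigma> ^^ n) f x\<bar> \<le> B)"
  proof (induction n)
    case (Suc n)
    then show ?case
      using euler_kernel_lipschitz[OF assms(1), of "(euler_kernel \<sigma> ^^ n) f" L B] by simp
  qed (use lip bnd in simp)
  then show "\<bar>(euler_kernel \<sigma> ^^ n) f x - (euler_kernel \<sigma> ^^ n) f y\<bar> \<le> L * \<bar>x - y\<bar>"
    and "\<bar>(euler_kernel \<sigma> ^^ n) f x\<bar> \<le> B" by auto
qed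

lemma iterated_step_error:
  assumes \<sigma>: "0 < \<sigma>" "\<sigma> \<le> 1"
    and lip: "\<And>x y. \<bar>f x - f y\<bar> \<le> L * \<bar>x - y\<bar>" and bnd: "\<And>x. \<bar>f x\<bar> \<le> B"
  shows "\<bar>(\<integral>x. (euler_kernel \<sigma> ^^ n) f x \<partial>gibbs) - (\<integral>x. f x \<partial>gibbs)\<bar>
     \<le> n * (L * (6 * K * \<sigma> ^ 3 * (\<integral>z. 1 / (1 + z\<^sup>2) \<partial>lborel)))"
proof (induction n)
  case (Suc n)
  have "\<bar>(\<integral>x. euler_kernel \<sigma> ((euler_kernel \<sigma> ^^ n) f) x \<partial>gibbs) - (\<integral>x. (euler_kernel \<sigma> ^^ n) f x \<partial>gibbs)\<bar>
      \<le> L * (6 * K * \<sigma> ^ 3 * (\<integral>z. 1 / (1 + z\<^sup>2) \<partial>lborel))"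
    by (rule one_step_error[OF \<sigma>]) (rule funpow_euler_kernel_regular[OF \<sigma>(1) lip bnd])+
  then show ?case using Suc by (simp add: distrib_right) 
qed simp

end

section \<open>The one-dimensional measures\<close>

lemma abs_powr_tendsto_0:
  fixes a :: real
  assumes "a > 0"
  shows "((\<lambda>h. \<bar>h\<bar> powr a) \<longlongrightarrow> 0) (at (0::real))"
proof -
  have "((\<lambda>h::real. \<bar>h\<bar> powr a) \<longlongrightarrow> 0 powr a) (at 0)"
    by (rule tendsto_powr') (auto intro!: tendsto_rabs_zero tendsto_ident_at simp: assms)
  then show ?thesis using assms by simp
qed

lemma has_real_derivative_abs_powr_nonzero:
  assumes "x \<noteq> 0"
  shows "((\<lambda>x. \<bar>x\<bar> powr a) has_real_derivative a * \<bar>x\<bar> powr (a - 2) * x) (at x)"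
proof (cases "x > 0")
  case True
  have "((\<lambda>x. x powr a) has_real_derivative a * \<bar>x\<bar> powr (a - 2) * x) (at x)"
  proof -
    have "((\<lambda>x. x powr a) has_real_derivative a * x powr (a - 1)) (at x)"
      using True by (rule has_real_derivative_powr)
    moreover have "x powr (a - 1) = x powr (a - 2) * x"
      using True powr_add[of x "a - 2" 1] by (simp add: algebra_simps)
    ultimately show ?thesis using True by (simp add: mult.assoc)
  qed
  then show ?thesis
    by (rule has_field_derivative_transform_within_open[where S = "{0<..}"]) (use True in auto)
next
  case False
  with assms have neg: "x < 0" by simp
  have "((\<lambda>x. (- x) powr a) has_real_derivative a * \<bar>x\<bar> powr (a - 2) * x) (at x)"
  proof -
    have "((\<lambda>x. (- x) powr a) has_real_derivative (a * (- x) powr (a - 1)) * (- 1)) (at x)"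
      by (rule DERIV_chain2[where f = "\<lambda>x. x powr a"])
         (use neg in \<open>auto intro!: has_real_derivative_powr derivative_eq_intros\<close>)
    moreover have "(- x) powr (a - 1) = (- x) powr (a - 2) * (- x)"
      using neg powr_add[of "- x" "a - 2" 1] by (simp add: algebra_simps)
    ultimately show ?thesis using neg by (simp add: mult.assoc)
  qed
  then show ?thesis
    by (rule has_field_derivative_transform_within_open[where S = "{..<0}"]) (use neg in auto)
qed

lemma has_real_derivative_abs_powr:
  assumes "a > 1"
  shows "((\<lambda>x. \<bar>x\<bar> powr a) has_real_derivative a * \<bar>x\<bar> powr (a - 2) * x) (at x)"
proof (cases "x = 0")
  case True
  have "((\<lambda>h. \<bar>h\<bar> powr a / h) \<longlongrightarrow> 0) (at 0)"
  proof (rule tendsto_rabs_zero_cancel)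
    have "\<bar>h\<bar> powr (a - 1) = \<bar>\<bar>h\<bar> powr a / h\<bar>" if "h \<noteq> 0" for h
      using that powr_diff[of "\<bar>h\<bar>" a 1] by (simp add: abs_divide)
    then have "\<forall>\<^sub>F h in at 0. \<bar>h\<bar> powr (a - 1) = \<bar>\<bar>h\<bar> powr a / h\<bar>"
      by (simp add: eventually_at_filter)
    with abs_powr_tendsto_0[of "a - 1"] assms
    show "((\<lambda>h. \<bar>\<bar>h\<bar> powr a / h\<bar>) \<longlongrightarrow> 0) (at 0)"
      by (simp add: tendsto_cong)
  qed
  then show ?thesis using True by (simp add: DERIV_def)
qed (rule has_real_derivative_abs_powr_nonzero)

text \<open>
  For \<open>a = 0\<close> the function is the identity, but \<open>0 powr 0 = 0\<close> would give derivative 0 at the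
  origin; hence the case distinction in the formula.
\<close>

lemma has_real_derivative_signed_powr:
  assumes "a \<ge> 0"
  shows "((\<lambda>x. \<bar>x\<bar> powr a * x) has_real_derivative
    (a + 1) * (if a = 0 then 1 else \<bar>x\<bar> powr a)) (at x)"
proof (cases "x = 0")
  case True
  have "((\<lambda>h. \<bar>h\<bar> powr a) \<longlongrightarrow> (a + 1) * (if a = 0 then 1 else \<bar>x\<bar> powr a)) (at 0)"
  proof (cases "a = 0")
    case True
    have "\<forall>\<^sub>F h in at (0::real). \<bar>h\<bar> powr a = 1"
      using True by (simp add: eventually_at_filter)
    then show ?thesis using True by (simp add: tendsto_eventually)
  next
    case False
    then show ?thesis using abs_powr_tendsto_0[of a] assms \<open>x = 0\<close> by simp
  qed
  moreover have "\<forall>\<^sub>F h in at (0::real). \<bar>h\<bar> powr a = (\<bar>h\<bar> powr a * h) / h"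
    by (simp add: eventually_at_filter)
  ultimately show ?thesis using True by (simp add: DERIV_def tendsto_cong)
next
  case False
  have "((\<lambda>x. \<bar>x\<bar> powr a * x) has_real_derivative
      (a * \<bar>x\<bar> powr (a - 2) * x) * x + 1 * \<bar>x\<bar> powr a) (at x)"
    by (rule DERIV_mult[OF has_real_derivative_abs_powr_nonzero[OF False] DERIV_ident])
  moreover have "\<bar>x\<bar> powr a = \<bar>x\<bar> powr (a - 2) * x * x"
  proof -
    have "\<bar>x\<bar> powr a = \<bar>x\<bar> powr (a - 2) * \<bar>x\<bar> powr 2"
      using powr_add[of "\<bar>x\<bar>" "a - 2" 2] by simp
    also have "\<bar>x\<bar> powr 2 = x * x" using False by (simp add: powr_numeral power2_eq_square)
    finally show ?thesis by (simp add: mult.assoc)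
  qed
  then have "(a * \<bar>x\<bar> powr (a - 2) * x) * x + 1 * \<bar>x\<bar> powr a = (a + 1) * \<bar>x\<bar> powr a"
    by (simp add: algebra_simps)
  moreover have "\<bar>x\<bar> powr a = (if a = 0 then 1 else \<bar>x\<bar> powr a)" using False by simp
  ultimately show ?thesis by simp
qed

text \<open>
  Use \<open>1 + \<bar>x\<bar> \<le> exp \<bar>x\<bar>\<close> and \<open>\<bar>x\<bar>\<^sup>2 - 1 \<le> \<bar>x\<bar> powr (2 * m)\<close>, then complete the square in the exponent.
\<close>

lemma poly_times_gibbs_bounded:
  fixes m \<mu> N :: real
  assumes m: "m \<ge> 1" and \<mu>: "\<mu> > 0" and "N \<ge> 0"
  shows "\<exists>K. \<forall>x. (1 + \<bar>x\<bar>) powr N * exp (- (\<bar>x\<bar> powr (2 * m)) / (2 * m * \<mu>)) \<le> K"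
proof (intro exI allI)
  fix x :: real
  define c where "c = 1 / (2 * m * \<mu>)"
  have "c > 0" using m \<mu> by (simp add: c_def)
  have "(1 + \<bar>x\<bar>) powr N \<le> exp \<bar>x\<bar> powr N"
    using exp_ge_add_one_self[of "\<bar>x\<bar>"] \<open>N \<ge> 0\<close> by (intro powr_mono2) auto
  also have "\<dots> = exp (N * \<bar>x\<bar>)" by (simp add: powr_def)
  finally have 1: "(1 + \<bar>x\<bar>) powr N \<le> exp (N * \<bar>x\<bar>)" .
  have "\<bar>x\<bar>\<^sup>2 - 1 \<le> \<bar>x\<bar> powr (2 * m)"
  proof (cases "\<bar>x\<bar> \<ge> 1")
    case True
    then have "\<bar>x\<bar> powr 2 \<le> \<bar>x\<bar> powr (2 * m)" using m by (intro powr_mono) auto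
    then show ?thesis using True by (simp add: powr_numeral)
  next
    case False
    then have "\<bar>x\<bar>\<^sup>2 \<le> 1" by (simp add: abs_square_le_1)
    moreover have "0 \<le> \<bar>x\<bar> powr (2 * m)" by simp
    ultimately show ?thesis by linarith
  qed
  then have "c * (\<bar>x\<bar>\<^sup>2 - 1) \<le> c * \<bar>x\<bar> powr (2 * m)" using \<open>c > 0\<close> by simp
  moreover have "N * \<bar>x\<bar> - c * (\<bar>x\<bar>\<^sup>2 - 1) \<le> c + N\<^sup>2 / (4 * c)"
  proof -
    have "0 \<le> (2 * c * \<bar>x\<bar> - N)\<^sup>2 / (4 * c)" using \<open>c > 0\<close> by simp
    also have "\<dots> = c * \<bar>x\<bar>\<^sup>2 - N * \<bar>x\<bar> + N\<^sup>2 / (4 * c)"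
      using \<open>c > 0\<close> by (simp add: field_simps power2_eq_square)
    finally show ?thesis by (simp add: algebra_simps)
  qed
  ultimately have "N * \<bar>x\<bar> + - (c * \<bar>x\<bar> powr (2 * m)) \<le> c + N\<^sup>2 / (4 * c)" by linarith
  moreover have "(1 + \<bar>x\<bar>) powr N * exp (- (c * \<bar>x\<bar> powr (2 * m)))
      \<le> exp (N * \<bar>x\<bar>) * exp (- (c * \<bar>x\<bar> powr (2 * m)))"
    using 1 by (intro mult_right_mono) auto
  moreover have "exp (N * \<bar>x\<bar>) * exp (- (c * \<bar>x\<bar> powr (2 * m)))
      = exp (N * \<bar>x\<bar> + - (c * \<bar>x\<bar> powr (2 * m)))"
    by (rule exp_add[symmetric])
  ultimately have "(1 + \<bar>x\<bar>) powr N * exp (- (c * \<bar>x\<bar> powr (2 * m))) \<le> exp (c + N\<^sup>2 / (4 * c))"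
    by (simp only: exp_le_cancel_iff order_trans)
  then show "(1 + \<bar>x\<bar>) powr N * exp (- (\<bar>x\<bar> powr (2 * m)) / (2 * m * \<mu>))
      \<le> exp (1 / (2 * m * \<mu>) + N\<^sup>2 / (4 * (1 / (2 * m * \<mu>))))"
    by (simp add: c_def)
qed

definition density1 :: "real \<Rightarrow> real \<Rightarrow> real \<Rightarrow> real" where
  "density1 m \<mu> \<xi> = (2 * m) powr (1 - 1 / (2 * m)) / (2 * Gamma (1 / (2 * m)))
        * \<mu> powr (- 1 / (2 * m)) * exp (- (\<bar>\<xi>\<bar> powr (2 * m)) / (2 * m * \<mu>))"

lemma nu1_density1: "nu1 m \<mu> = density lborel (density1 m \<mu>)"
  by (simp add: nu1_def density1_def)

lemma density1_nonneg: "m \<ge> 1 \<Longrightarrow> 0 \<le> density1 m \<mu> x"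
  by (simp add: density1_def Gamma_real_nonneg)

lemma density1_measurable[measurable]: "density1 m \<mu> \<in> borel_measurable borel"
  unfolding density1_def by measurable

lemma density1_poly_decay:
  fixes m \<mu> :: real
  assumes m: "m \<ge> 1" and \<mu>: "\<mu> > 0" and "N \<ge> 0"
  shows "\<exists>K. \<forall>x. (1 + \<bar>x\<bar>) powr N * density1 m \<mu> x \<le> K * (1 / (1 + x\<^sup>2))"
proof -
  define C where "C = (2 * m) powr (1 - 1 / (2 * m)) / (2 * Gamma (1 / (2 * m))) * \<mu> powr (- 1 / (2 * m))"
  have "C \<ge> 0" using m by (simp add: C_def Gamma_real_nonneg)
  obtain K where K: "\<And>x. (1 + \<bar>x\<bar>) powr (N + 2) * exp (- (\<bar>x\<bar> powr (2 * m)) / (2 * m * \<mu>)) \<le> K"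
    using poly_times_gibbs_bounded[OF m \<mu>, of "N + 2"] \<open>N \<ge> 0\<close> by auto
  have "(1 + \<bar>x\<bar>) powr N * density1 m \<mu> x \<le> C * K * (1 / (1 + x\<^sup>2))" for x
  proof -
    define E where "E = exp (- (\<bar>x\<bar> powr (2 * m)) / (2 * m * \<mu>))"
    have "(1 + \<bar>x\<bar>) powr (N + 2) = (1 + \<bar>x\<bar>) powr N * (1 + \<bar>x\<bar>)\<^sup>2"
      by (simp add: powr_add powr_numeral)
    moreover have "1 + x\<^sup>2 \<le> (1 + \<bar>x\<bar>)\<^sup>2" by (simp add: power2_sum)
    then have "(1 + \<bar>x\<bar>) powr N * (1 + x\<^sup>2) * E \<le> (1 + \<bar>x\<bar>) powr N * (1 + \<bar>x\<bar>)\<^sup>2 * E"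
      by (intro mult_right_mono mult_left_mono) (auto simp: E_def)
    ultimately have "(1 + \<bar>x\<bar>) powr N * (1 + x\<^sup>2) * E \<le> K" using K[of x] by (simp add: E_def)
    moreover have "0 < 1 + x\<^sup>2" by (simp add: add_pos_nonneg)
    ultimately have "(1 + \<bar>x\<bar>) powr N * E \<le> K * (1 / (1 + x\<^sup>2))" by (simp add: field_simps)
    then have "C * ((1 + \<bar>x\<bar>) powr N * E) \<le> C * (K * (1 / (1 + x\<^sup>2)))"
      using \<open>C \<ge> 0\<close> by (rule mult_left_mono)
    then show ?thesis by (simp add: density1_def C_def E_def mult_ac)
  qed
  then show ?thesis by blast
qed

lemma density1_moment_integrable:
  fixes m \<mu> :: real
  assumes m: "m \<ge> 1" and \<mu>: "\<mu> > 0" and "f \<in> borel_measurable borel"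
    and f: "\<And>x. \<bar>f x\<bar> \<le> (1 + \<bar>x\<bar>)\<^sup>2"
  shows "integrable lborel (\<lambda>x. density1 m \<mu> x * f x)"
proof -
  have [measurable]: "f \<in> borel_measurable borel" by fact
  obtain K where K: "\<And>x. (1 + \<bar>x\<bar>) powr 2 * density1 m \<mu> x \<le> K * (1 / (1 + x\<^sup>2))"
    using density1_poly_decay[OF m \<mu>, of 2] by auto
  show ?thesis
  proof (rule Bochner_Integration.integrable_bound)
    show "integrable lborel (\<lambda>x. K * (1 / (1 + x\<^sup>2)))"
      by (intro integrable_mult_right cauchy_weight_integrable)
    show "AE x in lborel. norm (density1 m \<mu> x * f x) \<le> norm (K * (1 / (1 + x\<^sup>2)))"
    proof (rule AE_I2)
      fix x
      have "norm (density1 m \<mu> x * f x) \<le> density1 m \<mu> x * (1 + \<bar>x\<bar>)\<^sup>2"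
        using f[of x] density1_nonneg[OF m, of \<mu> x] by (simp add: abs_mult mult_left_mono)
      also have "\<dots> \<le> K * (1 / (1 + x\<^sup>2))" using K[of x] by (simp add: powr_numeral mult.commute)
      finally have "norm (density1 m \<mu> x * f x) \<le> K * (1 / (1 + x\<^sup>2))" .
      from this abs_ge_self show "norm (density1 m \<mu> x * f x) \<le> norm (K * (1 / (1 + x\<^sup>2)))"
        unfolding real_norm_def by (rule order_trans)
    qed
  qed measurable
qed

text \<open>The substitution \<open>t = x powr (2 * m) / (2 * m * \<mu>)\<close> turns Euler's integral for \<open>Gamma\<close> into this one.\<close>

lemma gibbs_normalization:
  fixes m \<mu> :: real
  assumes m: "m \<ge> 1" and \<mu>: "\<mu> > 0"
  shows "has_bochner_integral lborel (\<lambda>x. exp (- (\<bar>x\<bar> powr (2 * m)) / (2 * m * \<mu>)))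
     (2 * (\<mu> * (2 * m * \<mu>) powr (1 / (2 * m) - 1) * Gamma (1 / (2 * m))))"
proof -
  define a where "a = 1 / (2 * m)"
  have a: "0 < a" "2 * m * a = 1" using m by (auto simp: a_def)
  define f where "f = (\<lambda>t::real. t powr (a - 1) * exp (- t))"
  define g where "g = (\<lambda>x::real. x powr (2 * m) / (2 * m * \<mu>))"
  define g' where "g' = (\<lambda>x::real. x powr (2 * m - 1) / \<mu>)"
  define E where "E = (\<lambda>x::real. exp (- (\<bar>x\<bar> powr (2 * m)) / (2 * m * \<mu>)))"
  define c where "c = (2 * m * \<mu>) powr (1 - a) / \<mu>"
  have "c > 0" using m \<mu> by (simp add: c_def)
  have fg: "f (g x) * g' x = c * E x" if "x > 0" for x
  proof -
    have "(x powr (2 * m) / (2 * m * \<mu>)) powr (a - 1)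
        = x powr (2 * m * (a - 1)) / (2 * m * \<mu>) powr (a - 1)"
      using that m \<mu> by (simp add: powr_divide powr_powr)
    also have "2 * m * (a - 1) = 1 - 2 * m" using a by (simp add: algebra_simps)
    also have "x powr (1 - 2 * m) / (2 * m * \<mu>) powr (a - 1) = x powr (1 - 2 * m) * (2 * m * \<mu>) powr (1 - a)"
      using powr_minus_divide[of "2 * m * \<mu>" "a - 1"] m \<mu> by simp
    finally have "f (g x) * g' x = (x powr (1 - 2 * m) * x powr (2 * m - 1)) * c * exp (- g x)"
      by (simp add: f_def g_def g'_def c_def)
    also have "x powr (1 - 2 * m) * x powr (2 * m - 1) = 1"
      using powr_add[of x "1 - 2 * m" "2 * m - 1"] that by simp
    finally show ?thesis using that by (simp add: E_def g_def)
  qed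
  have E_int: "integrable lborel E"
  proof -
    obtain K where K: "\<And>x. (1 + \<bar>x\<bar>) powr 2 * E x \<le> K"
      using poly_times_gibbs_bounded[OF m \<mu>, of 2] unfolding E_def by auto
    show ?thesis
    proof (rule Bochner_Integration.integrable_bound)
      show "integrable lborel (\<lambda>x. K * (1 / (1 + x\<^sup>2)))"
        by (intro integrable_mult_right cauchy_weight_integrable)
      show "AE x in lborel. norm (E x) \<le> norm (K * (1 / (1 + x\<^sup>2)))"
      proof (rule AE_I2)
        fix x :: real
        have "1 + x\<^sup>2 \<le> (1 + \<bar>x\<bar>)\<^sup>2" by (simp add: power2_sum)
        then have "(1 + x\<^sup>2) * E x \<le> (1 + \<bar>x\<bar>)\<^sup>2 * E x"
          by (intro mult_right_mono) (auto simp: E_def)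
        also have "\<dots> \<le> K" using K[of x] by (simp add: powr_numeral)
        finally have "E x \<le> K * (1 / (1 + x\<^sup>2))"
          using add_pos_nonneg[of 1 "x\<^sup>2"] by (simp add: field_simps)
        also have "\<dots> \<le> norm (K * (1 / (1 + x\<^sup>2)))" unfolding real_norm_def by (rule abs_ge_self)
        finally show "norm (E x) \<le> norm (K * (1 / (1 + x\<^sup>2)))" by (simp add: E_def)
      qed
    qed (simp add: E_def)
  qed
  have ein: "einterval 0 \<infinity> = {0<..}" by (auto simp: einterval_def)
  have int_fg: "set_integrable lborel (einterval 0 \<infinity>) (\<lambda>x. f (g x) * g' x)"
  proof -
    have "set_integrable lborel {0<..} (\<lambda>x. c * E x)"
      unfolding set_integrable_def
      by (rule integrable_mult_indicator) (use E_int in auto)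
    then show ?thesis
      unfolding ein by (rule set_integrable_cong[THEN iffD1, rotated -1]) (auto simp: fg)
  qed
  have glim0: "((ereal \<circ> g \<circ> real_of_ereal) \<longlongrightarrow> 0) (at_right 0)"
  proof -
    have "(g \<longlongrightarrow> 0) (at_right 0)"
    proof -
      have "((\<lambda>x::real. x powr (2 * m)) \<longlongrightarrow> 0 powr (2 * m)) (at_right 0)"
        using m by (intro tendsto_powr') (auto intro!: tendsto_ident_at simp: eventually_at_right_less eventually_at_filter)
      then have "((\<lambda>x::real. x powr (2 * m) / (2 * m * \<mu>)) \<longlongrightarrow> 0 / (2 * m * \<mu>)) (at_right 0)"
        using m \<mu> by (intro tendsto_divide) auto
      then show ?thesis by (simp add: g_def)
    qed
    then show ?thesis by (simp add: zero_ereal_def ereal_tendsto_simps)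
  qed
  have gliminf: "((ereal \<circ> g \<circ> real_of_ereal) \<longlongrightarrow> \<infinity>) (at_left \<infinity>)"
  proof -
    have "filterlim g at_top at_top"
    proof (rule filterlim_at_top_mono)
      show "filterlim (\<lambda>x. (1 / (2 * m * \<mu>)) * x) at_top at_top"
        by (rule filterlim_tendsto_pos_mult_at_top[OF tendsto_const _ filterlim_ident]) (use m \<mu> in auto)
      show "\<forall>\<^sub>F x in at_top. (1 / (2 * m * \<mu>)) * x \<le> g x"
        using eventually_ge_at_top[of 1]
      proof eventually_elim
        case (elim x)
        have "x powr 1 \<le> x powr (2 * m)" using elim m by (intro powr_mono) auto
        then show ?case using elim m \<mu> by (simp add: g_def divide_right_mono)
      qed
    qed
    then show ?thesis by (simp add: ereal_tendsto_simps)
  qed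
  have sub: "set_integrable lborel (einterval 0 \<infinity>) f"
    "(LBINT x=0..\<infinity>. f x) = (LBINT x=0..\<infinity>. f (g x) * g' x)"
  proof -
    have 1: "(g has_real_derivative g' x) (at x)" if "0 < ereal x" for x
    proof -
      have "((\<lambda>x. x powr (2 * m)) has_real_derivative 2 * m * x powr (2 * m - 1)) (at x)"
        using that by (intro has_real_derivative_powr) (simp add: zero_ereal_def)
      from DERIV_cdivide[OF this, of "2 * m * \<mu>"] show ?thesis
        using m by (simp add: g_def g'_def)
    qed
    have 2: "isCont f (g x)" if "0 < ereal x" for x
      using that m \<mu> unfolding f_def by (intro continuous_intros) (auto simp: g_def zero_ereal_def)
    have 3: "isCont g' x" if "0 < ereal x" for x
      using that \<mu> unfolding g'_def by (intro continuous_intros) (auto simp: zero_ereal_def)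
    show "set_integrable lborel (einterval 0 \<infinity>) f"
      "(LBINT x=0..\<infinity>. f x) = (LBINT x=0..\<infinity>. f (g x) * g' x)"
      using interval_integral_substitution_nonneg[of 0 \<infinity> g g' f, OF _ 1 2 3 _ _ glim0 gliminf int_fg] \<mu>
      by (auto simp: f_def g'_def)
  qed
  have "(f has_integral Gamma a) {0..}"
    using Gamma_integral_real[OF a(1)] by (simp add: f_def exp_minus divide_inverse)
  moreover have "(f has_integral Gamma a) {0..} \<longleftrightarrow> (f has_integral Gamma a) {0<..}"
    by (rule has_integral_spike_set_eq) (rule negligible_subset[OF negligible_sing[of 0]], force)+
  ultimately have "(f has_integral Gamma a) {0<..}" by simp
  moreover have "(f has_integral (LBINT x:{0<..}. f x)) {0<..}"
    using set_borel_integral_eq_integral[OF sub(1)[unfolded ein]] by (simp add: has_integral_integrable_integral)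
  ultimately have "Gamma a = (LBINT x:{0<..}. f x)" by (rule has_integral_unique)
  also have "\<dots> = (LBINT x=0..\<infinity>. f x)" by (simp add: interval_lebesgue_integral_def ein)
  also have "\<dots> = (LBINT x:{0<..}. f (g x) * g' x)"
    unfolding sub(2) by (simp add: interval_lebesgue_integral_def ein)
  also have "\<dots> = (LBINT x:{0<..}. c * E x)"
    by (intro set_lebesgue_integral_cong) (auto simp: fg)
  also have "\<dots> = c * (LBINT x:{0<..}. E x)" by simp
  finally have "(LBINT x:{0<..}. E x) = Gamma a / c" using \<open>c > 0\<close> by simp
  moreover have "(LBINT x:{0<..}. E x) = (\<integral>x. indicator {0..} x *\<^sub>R E x \<partial>lborel)"
    unfolding set_lebesgue_integral_def
  proof (rule integral_cong_AE)
    show "AE x in lborel. indicat_real {0<..} x *\<^sub>R E x = indicat_real {0..} x *\<^sub>R E x"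
      using AE_lborel_singleton[of 0]
    proof eventually_elim
      case (elim x)
      then show ?case by (auto simp: indicator_def)
    qed
  qed (use E_int in auto)
  moreover have "integrable lborel (\<lambda>x. indicator {0..} x *\<^sub>R E x)"
    by (rule integrable_mult_indicator) (use E_int in auto)
  ultimately have "has_bochner_integral lborel (\<lambda>x. indicator {0..} x *\<^sub>R E x) (Gamma a / c)"
    by (simp add: has_bochner_integral_iff)
  then have "has_bochner_integral lborel E (2 *\<^sub>R (Gamma a / c))"
    by (rule has_bochner_integral_even_function) (simp add: E_def)
  moreover have "Gamma a / c = \<mu> * (2 * m * \<mu>) powr (a - 1) * Gamma a"
    using powr_minus_divide[of "2 * m * \<mu>" "1 - a"] m \<mu> by (simp add: c_def)
  ultimately show ?thesis unfolding E_def a_def by simp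
qed

lemma prob_space_nu1:
  fixes m \<mu> :: real
  assumes m: "m \<ge> 1" and \<mu>: "\<mu> > 0"
  shows "prob_space (nu1 m \<mu>)"
proof
  define a where "a = 1 / (2 * m)"
  have "0 < a" using m by (simp add: a_def)
  then have "Gamma a > 0" by (rule Gamma_real_pos)
  have "has_bochner_integral lborel (density1 m \<mu>)
      ((2 * m) powr (1 - a) / (2 * Gamma a) * \<mu> powr (- a) * (2 * (\<mu> * (2 * m * \<mu>) powr (a - 1) * Gamma a)))"
  proof -
    have minus_a: "- 1 / (2 * m) = - a" by (simp add: a_def)
    have "density1 m \<mu> = (\<lambda>x. (2 * m) powr (1 - a) / (2 * Gamma a) * \<mu> powr (- a) *
        exp (- (\<bar>x\<bar> powr (2 * m)) / (2 * m * \<mu>)))"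
      unfolding density1_def[abs_def] minus_a a_def[symmetric] by (rule refl)
    moreover note has_bochner_integral_mult_right[OF gibbs_normalization[OF m \<mu>, folded a_def],
        of "(2 * m) powr (1 - a) / (2 * Gamma a) * \<mu> powr (- a)"]
    ultimately show ?thesis by (simp only:)
  qed
  also have "(2 * m) powr (1 - a) / (2 * Gamma a) * \<mu> powr (- a) * (2 * (\<mu> * (2 * m * \<mu>) powr (a - 1) * Gamma a)) = 1"
  proof -
    have 1: "(2 * m) powr (1 - a) * (2 * m) powr (a - 1) = 1"
      using powr_add[of "2 * m" "1 - a" "a - 1"] m by simp
    have 2: "\<mu> powr (- a) * (\<mu> * \<mu> powr (a - 1)) = 1"
      using powr_add[of \<mu> "1" "a - 1"] powr_add[of \<mu> "- a" a] \<mu> by simp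
    have alg: "(2 * m) powr (1 - a) / (2 * G) * \<mu> powr (- a) * (2 * (\<mu> * ((2 * m) powr (a - 1) * \<mu> powr (a - 1)) * G))
        = ((2 * m) powr (1 - a) * (2 * m) powr (a - 1)) * (\<mu> powr (- a) * (\<mu> * \<mu> powr (a - 1)))"
      if "G \<noteq> 0" for G :: real
      using that by simp
    have split: "(2 * m * \<mu>) powr (a - 1) = (2 * m) powr (a - 1) * \<mu> powr (a - 1)"
      by (rule powr_mult)
    have "Gamma a \<noteq> 0" using \<open>Gamma a > 0\<close> by simp
    from alg[OF this] show ?thesis unfolding split 1 2 by (rule trans) simp
  qed
  finally have "has_bochner_integral lborel (density1 m \<mu>) 1" .
  then show "emeasure (nu1 m \<mu>) (space (nu1 m \<mu>)) = 1"
    unfolding nu1_density1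
    by (simp add: emeasure_density nn_integral_eq_integral has_bochner_integral_iff density1_nonneg[OF m])
qed

text \<open>The measure \<open>nu1 m \<mu>\<close> is the image of \<open>nu1 m 1\<close> under multiplication by \<open>\<mu> powr (1 / (2 * m))\<close>.\<close>

lemma nu1_second_moment_scaling:
  fixes m \<mu> :: real
  assumes m: "m \<ge> 1" and \<mu>: "\<mu> > 0"
  shows "(\<integral>\<^sup>+x. ennreal (x\<^sup>2) \<partial>nu1 m \<mu>) = ennreal (\<mu> powr (1 / m)) * (\<integral>\<^sup>+x. ennreal (x\<^sup>2) \<partial>nu1 m 1)"
proof -
  define c where "c = \<mu> powr (1 / (2 * m))"
  have "c > 0" using \<mu> by (simp add: c_def)
  have c2: "c\<^sup>2 = \<mu> powr (1 / m)"
    using powr_add[of \<mu> "1 / (2 * m)" "1 / (2 * m)"] by (simp add: c_def power2_eq_square)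
  have scale: "c * density1 m \<mu> (c * x) = density1 m 1 x" for x
  proof -
    have "\<bar>c * x\<bar> powr (2 * m) = \<mu> * \<bar>x\<bar> powr (2 * m)"
      using m \<mu> \<open>c > 0\<close> by (simp add: abs_mult powr_mult c_def powr_powr)
    moreover have "c * \<mu> powr (- 1 / (2 * m)) = 1"
      using powr_add[of \<mu> "1 / (2 * m)" "- 1 / (2 * m)"] \<mu> by (simp add: c_def)
    ultimately show ?thesis using \<mu> by (simp add: density1_def mult_ac)
  qed
  have "(\<integral>\<^sup>+x. ennreal (x\<^sup>2) \<partial>nu1 m \<mu>) = (\<integral>\<^sup>+x. ennreal (density1 m \<mu> x) * ennreal (x\<^sup>2) \<partial>lborel)"
    unfolding nu1_density1 by (subst nn_integral_density) auto
  also have "\<dots> = ennreal \<bar>c\<bar> * (\<integral>\<^sup>+x. ennreal (density1 m \<mu> (0 + c * x)) * ennreal ((0 + c * x)\<^sup>2) \<partial>lborel)"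
    by (rule nn_integral_real_affine) (use \<open>c > 0\<close> in auto)
  also have "\<dots> = (\<integral>\<^sup>+x. ennreal c * (ennreal (density1 m \<mu> (c * x)) * ennreal ((c * x)\<^sup>2)) \<partial>lborel)"
    using \<open>c > 0\<close> by (subst nn_integral_cmult) auto
  also have "\<dots> = (\<integral>\<^sup>+x. ennreal (\<mu> powr (1 / m)) * (ennreal (density1 m 1 x) * ennreal (x\<^sup>2)) \<partial>lborel)"
  proof (rule nn_integral_cong)
    fix x
    have "c * (density1 m \<mu> (c * x) * (c * x)\<^sup>2) = c\<^sup>2 * ((c * density1 m \<mu> (c * x)) * x\<^sup>2)"
      by (simp add: power_mult_distrib)
    also have "\<dots> = \<mu> powr (1 / m) * (density1 m 1 x * x\<^sup>2)" by (simp only: scale c2)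
    finally show "ennreal c * (ennreal (density1 m \<mu> (c * x)) * ennreal ((c * x)\<^sup>2))
        = ennreal (\<mu> powr (1 / m)) * (ennreal (density1 m 1 x) * ennreal (x\<^sup>2))"
      using \<open>c > 0\<close> by (simp add: ennreal_mult''[symmetric] density1_nonneg[OF m])
  qed
  also have "\<dots> = ennreal (\<mu> powr (1 / m)) * (\<integral>\<^sup>+x. ennreal (x\<^sup>2) \<partial>nu1 m 1)"
    unfolding nu1_density1 by (subst nn_integral_cmult) (auto simp: nn_integral_density)
  finally show ?thesis .
qed

lemma nu1_second_moment_finite:
  fixes m :: real
  assumes m: "m \<ge> 1"
  shows "(\<integral>\<^sup>+x. ennreal (x\<^sup>2) \<partial>nu1 m 1) < \<infinity>"
proof -
  have "integrable lborel (\<lambda>x. density1 m 1 x * x\<^sup>2)"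
    using m by (intro density1_moment_integrable) (auto simp: power2_sum)
  then have "(\<integral>\<^sup>+x. ennreal (density1 m 1 x * x\<^sup>2) \<partial>lborel) < \<infinity>"
    using density1_nonneg[OF m] by (simp add: nn_integral_eq_integral)
  then show ?thesis
    unfolding nu1_density1 by (simp add: nn_integral_density ennreal_mult density1_nonneg[OF m])
qed

text \<open>
  Every quantity to be bounded is a polynomial in \<open>y x = (1 + \<bar>x\<bar>) powr (2 * m - 1)\<close> of degree at
  most 3 times the density.
\<close>

lemma gibbs_density_density1:
  fixes m \<mu> :: real
  assumes m: "m \<ge> 1" and \<mu>: "\<mu> > 0"
  shows "\<exists>q K. gibbs_density (drift m \<mu>) (density1 m \<mu>) q K"
proof -
  define b where "b = drift m \<mu>"
  define p where "p = density1 m \<mu>"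
  define B where "B = 1 / (2 * \<mu>)"
  have "B > 0" using \<mu> by (simp add: B_def)
  have b_eq: "b x = - B * (\<bar>x\<bar> powr (2 * m - 2) * x)" for x
    by (simp add: b_def drift_def B_def)
  have b_abs: "\<bar>b x\<bar> = B * \<bar>x\<bar> powr (2 * m - 1)" for x
  proof -
    have "\<bar>x\<bar> powr (2 * m - 2) * \<bar>x\<bar> = \<bar>x\<bar> powr (2 * m - 1)"
      using powr_add[of "\<bar>x\<bar>" "2 * m - 2" 1] by simp
    then show ?thesis using \<open>B > 0\<close> by (simp add: b_eq abs_mult)
  qed
  have b_abs_mono: "\<bar>b x\<bar> \<le> \<bar>b y\<bar>" if "\<bar>x\<bar> \<le> \<bar>y\<bar>" for x y
    unfolding b_abs using that m \<open>B > 0\<close> by (intro mult_left_mono powr_mono2) auto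
  have b_nonpos: "b x \<le> 0" if "0 \<le> x" for x
  proof -
    have "0 \<le> B * (\<bar>x\<bar> powr (2 * m - 2) * x)"
      using that \<open>B > 0\<close> by (intro mult_nonneg_nonneg) auto
    then show ?thesis unfolding b_eq by linarith
  qed
  have b_nonneg: "0 \<le> b x" if "x \<le> 0" for x
  proof -
    have "0 \<le> B * (\<bar>x\<bar> powr (2 * m - 2) * (- x))"
      using that \<open>B > 0\<close> by (intro mult_nonneg_nonneg) auto
    then show ?thesis unfolding b_eq by (simp only: mult_minus_right mult_minus_left)
  qed
  have b_antimono: "b y \<le> b x" if "x \<le> y" for x y
  proof -
    consider "0 \<le> x" | "x \<le> 0" "0 \<le> y" | "y \<le> 0" by linarith
    then show ?thesis
    proof cases
      case 1
      then have "\<bar>b x\<bar> \<le> \<bar>b y\<bar>" using that by (intro b_abs_mono) simp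
      then show ?thesis using b_nonpos[of x] b_nonpos[of y] 1 that by linarith
    next
      case 2
      then show ?thesis using b_nonneg[of x] b_nonpos[of y] by linarith
    next
      case 3
      then have "\<bar>b y\<bar> \<le> \<bar>b x\<bar>" using that by (intro b_abs_mono) simp
      then show ?thesis using b_nonneg[of x] b_nonneg[of y] 3 that by linarith
    qed
  qed
  define k where "k x = (if 2 * m - 2 = 0 then 1 else \<bar>x\<bar> powr (2 * m - 2))" for x
  define b' where "b' x = - B * ((2 * m - 1) * k x)" for x
  have b_deriv: "(b has_real_derivative b' x) (at x)" for x
    unfolding b_eq[abs_def] b'_def k_def
    using has_real_derivative_signed_powr[of "2 * m - 2" x] m
    by (intro DERIV_cmult) (simp add: algebra_simps)
  have p_deriv: "(p has_real_derivative 2 * b x * p x) (at x)" for x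
  proof -
    define C where "C = (2 * m) powr (1 - 1 / (2 * m)) / (2 * Gamma (1 / (2 * m))) * \<mu> powr (- 1 / (2 * m))"
    have p_eq: "p = (\<lambda>x. C * exp (- (\<bar>x\<bar> powr (2 * m)) / (2 * m * \<mu>)))"
      by (simp add: p_def density1_def[abs_def] C_def)
    have "((\<lambda>x. - (\<bar>x\<bar> powr (2 * m)) / (2 * m * \<mu>)) has_real_derivative
        - (2 * m * \<bar>x\<bar> powr (2 * m - 2) * x) / (2 * m * \<mu>)) (at x)"
      using m by (intro DERIV_cdivide DERIV_minus has_real_derivative_abs_powr) simp
    also have "- (2 * m * \<bar>x\<bar> powr (2 * m - 2) * x) / (2 * m * \<mu>) = 2 * b x"
      using m \<mu> by (simp add: b_eq B_def)
    finally have "((\<lambda>x. C * exp (- (\<bar>x\<bar> powr (2 * m)) / (2 * m * \<mu>))) has_real_derivative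
        C * (exp (- (\<bar>x\<bar> powr (2 * m)) / (2 * m * \<mu>)) * (2 * b x))) (at x)"
      by (intro DERIV_cmult DERIV_fun_exp)
    then show ?thesis by (simp add: p_eq mult_ac)
  qed
  define q where "q x = (2 * b' x + 4 * (b x)\<^sup>2) * p x" for x
  have q_deriv: "((\<lambda>x. 2 * b x * p x) has_real_derivative q x) (at x)" for x
  proof -
    have "((\<lambda>x. 2 * b x * p x) has_real_derivative (2 * b' x) * p x + (2 * b x * p x) * (2 * b x)) (at x)"
      by (intro DERIV_mult DERIV_cmult b_deriv p_deriv)
    then show ?thesis by (simp add: q_def power2_eq_square algebra_simps)
  qed
  have p_nonneg: "0 \<le> p x" for x using density1_nonneg[OF m] by (simp add: p_def)
  define y where "y x = (1 + \<bar>x\<bar>) powr (2 * m - 1)" for x :: real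
  have y1: "1 \<le> y x" for x using m by (simp add: y_def ge_one_powr_ge_zero)
  have b_le: "\<bar>b x\<bar> \<le> B * y x" for x
    unfolding b_abs y_def using m \<open>B > 0\<close> by (intro mult_left_mono powr_mono2) auto
  have "k x \<le> y x" for x
  proof (cases "2 * m - 2 = 0")
    case False
    have "\<bar>x\<bar> powr (2 * m - 2) \<le> (1 + \<bar>x\<bar>) powr (2 * m - 2)" using m by (intro powr_mono2) auto
    also have "\<dots> \<le> y x" unfolding y_def by (intro powr_mono) auto
    finally show ?thesis using False by (simp add: k_def)
  qed (simp add: k_def y1)
  then have b'_le: "\<bar>b' x\<bar> \<le> B * ((2 * m - 1) * y x)" for x
    using m \<open>B > 0\<close> by (simp add: b'_def k_def abs_mult mult_left_mono)
  \<comment> \<open>\<open>q\<close> is at most \<open>D y\<^sup>2 p\<close>, from \<open>q = (2 b' + 4 b\<^sup>2) p\<close>\<close>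
  define D where "D = 2 * (B * (2 * m - 1)) + 4 * B\<^sup>2"
  have "D \<ge> 0" using m \<open>B > 0\<close> by (simp add: D_def)
  have q_le: "\<bar>q x\<bar> \<le> D * (y x)\<^sup>2 * p x" for x
  proof -
    have "\<bar>2 * b' x + 4 * (b x)\<^sup>2\<bar> \<le> 2 * \<bar>b' x\<bar> + 4 * \<bar>b x\<bar>\<^sup>2"
    proof -
      have "\<bar>b x\<bar>\<^sup>2 = (b x)\<^sup>2" "0 \<le> (b x)\<^sup>2" by simp_all
      then show ?thesis by linarith
    qed
    also have "\<dots> \<le> 2 * (B * ((2 * m - 1) * (y x)\<^sup>2)) + 4 * (B * y x)\<^sup>2"
    proof (intro add_mono mult_left_mono power_mono b_le)
      have "y x \<le> (y x)\<^sup>2" using y1[of x] by (simp add: power2_eq_square)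
      then have "B * ((2 * m - 1) * y x) \<le> B * ((2 * m - 1) * (y x)\<^sup>2)"
        using m \<open>B > 0\<close> by (intro mult_left_mono) auto
      then show "\<bar>b' x\<bar> \<le> B * ((2 * m - 1) * (y x)\<^sup>2)" using b'_le[of x] by linarith
    qed auto
    also have "\<dots> = D * (y x)\<^sup>2" by (simp add: D_def power_mult_distrib algebra_simps)
    finally show ?thesis unfolding q_def abs_mult using p_nonneg[of x] by (simp add: mult_right_mono)
  qed
  obtain K0 where K0: "\<And>x. (1 + \<bar>x\<bar>) powr (3 * (2 * m - 1)) * p x \<le> K0 * (1 / (1 + x\<^sup>2))"
    using density1_poly_decay[OF m \<mu>, of "3 * (2 * m - 1)"] m unfolding p_def by auto
  have y3: "(y x) ^ 3 * p x \<le> K0 * (1 / (1 + x\<^sup>2))" for x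
  proof -
    have "(y x) ^ 3 = (1 + \<bar>x\<bar>) powr (3 * (2 * m - 1))"
      by (simp add: y_def powr_power mult.commute)
    then show ?thesis using K0[of x] by simp
  qed
  have "K0 \<ge> 0"
  proof -
    have "0 \<le> (y 0) ^ 3 * p 0" using p_nonneg[of 0] y1[of 0] by (intro mult_nonneg_nonneg) auto
    also have "\<dots> \<le> K0 * (1 / (1 + 0\<^sup>2))" by (rule y3)
    finally show ?thesis by simp
  qed
  define K where "K = (D + B * D + B ^ 3) * K0"
  have bound: "c * ((y x) ^ 3 * p x) \<le> K * (1 / (1 + x\<^sup>2))" if "0 \<le> c" "c \<le> D + B * D + B ^ 3" for c x
  proof -
    have "c * ((y x) ^ 3 * p x) \<le> c * (K0 * (1 / (1 + x\<^sup>2)))"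
      using y3 that by (intro mult_left_mono) auto
    also have "\<dots> \<le> (D + B * D + B ^ 3) * (K0 * (1 / (1 + x\<^sup>2)))"
      using that \<open>K0 \<ge> 0\<close> by (intro mult_right_mono) auto
    finally show ?thesis by (simp add: K_def)
  qed
  have "gibbs_density b p q K"
  proof (intro gibbs_density.intro gibbs_density_axioms.intro decreasing_drift.intro)
    show "continuous_on UNIV b"
      using b_deriv DERIV_isCont by (intro continuous_at_imp_continuous_on) blast
    show "b 0 = 0" by (simp add: b_eq)
    show "prob_space (density lborel p)"
      using prob_space_nu1[OF m \<mu>] by (simp add: nu1_density1 p_def)
    have "integrable lborel (\<lambda>x. p x * x)"
      unfolding p_def using m \<mu> by (intro density1_moment_integrable) (auto simp: power2_sum)
    then show "integrable (density lborel p) (\<lambda>x. x)"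
      using p_nonneg by (subst integrable_density) (auto simp: p_def)
    fix x :: real
    have "\<bar>q x\<bar> \<le> D * ((y x) ^ 3 * p x)"
    proof -
      have "(y x)\<^sup>2 \<le> (y x) ^ 3" using y1[of x] by (intro power_increasing) auto
      then have "D * (y x)\<^sup>2 * p x \<le> D * (y x) ^ 3 * p x"
        using p_nonneg \<open>D \<ge> 0\<close> by (intro mult_right_mono mult_left_mono) auto
      then show ?thesis using q_le[of x] by simp
    qed
    then show "\<bar>q x\<bar> \<le> K * (1 / (1 + x\<^sup>2))"
      using bound[of D x] \<open>D \<ge> 0\<close> \<open>B > 0\<close> by simp
    have "\<bar>b x\<bar> * \<bar>q x\<bar> \<le> (B * y x) * (D * (y x)\<^sup>2 * p x)"
      using b_le[of x] q_le[of x] y1[of x] \<open>B > 0\<close> by (intro mult_mono) auto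
    also have "\<dots> = (B * D) * ((y x) ^ 3 * p x)" by (simp add: power2_eq_square power3_eq_cube)
    finally show "\<bar>b x\<bar> * \<bar>q x\<bar> \<le> K * (1 / (1 + x\<^sup>2))"
      using bound[of "B * D" x] \<open>D \<ge> 0\<close> \<open>B > 0\<close> by simp
    have "\<bar>b x\<bar> ^ 3 * p x \<le> (B * y x) ^ 3 * p x"
      using b_le[of x] p_nonneg by (intro mult_right_mono power_mono) auto
    then show "\<bar>b x\<bar> ^ 3 * p x \<le> K * (1 / (1 + x\<^sup>2))"
      using bound[of "B ^ 3" x] \<open>D \<ge> 0\<close> \<open>B > 0\<close> by (simp add: power_mult_distrib mult.assoc)
  qed (simp_all add: b_antimono b_abs_mono p_nonneg p_deriv q_deriv)
  then show ?thesis unfolding b_def p_def by blast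
qed

section \<open>The law of the scheme driven by Brownian increments\<close>

context gibbs_density
begin

text \<open>
  The position after \<open>k\<close> steps depends only on the first \<open>k\<close> increments and is therefore independent
  of the next one; integrating the latter out applies the kernel once.
\<close>

lemma implicit_euler_expectation:
  assumes "prob_space M" and \<sigma>: "0 < \<sigma>"
    and ind: "prob_space.indep_vars M (\<lambda>_. borel) \<Delta> {..<n}"
    and distr: "\<And>i. i < n \<Longrightarrow> distr M borel (\<Delta> i) = gaussian \<sigma>"
    and "k \<le> n"
    and lip: "\<And>x y. \<bar>f x - f y\<bar> \<le> L * \<bar>x - y\<bar>" and bnd: "\<And>x. \<bar>f x\<bar> \<le> B"
  shows "(\<integral>\<omega>. f (implicit_euler (\<sigma>\<^sup>2) (\<lambda>i. \<Delta> i \<omega>) k x) \<partial>M) = (euler_kernel \<sigma> ^^ k) f x"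
  using \<open>k \<le> n\<close> lip bnd
proof (induction k arbitrary: f)
  case 0
  interpret prob_space M by fact
  show ?case using prob_space by simp
next
  case (Suc k)
  interpret prob_space M by fact
  have f[measurable]: "f \<in> borel_measurable borel"
    by (rule borel_measurable_continuous_onI[OF lipschitz_real_continuous[OF Suc.prems(2)]])
  have [measurable]: "resolvent (\<sigma>\<^sup>2) \<in> borel_measurable borel" by simp
  define Z where "Z \<omega> = implicit_euler (\<sigma>\<^sup>2) (\<lambda>i. \<Delta> i \<omega>) k x" for \<omega>
  define h where "h = (\<lambda>(z, d). f (resolvent (\<sigma>\<^sup>2) (z + d)))"
  have h[measurable]: "h \<in> borel_measurable (borel \<Otimes>\<^sub>M borel)" unfolding h_def by measurable
  have "indep_var borel ((\<lambda>d. implicit_euler (\<sigma>\<^sup>2) d k x) \<circ> (\<lambda>\<omega>. restrict (\<lambda>i. \<Delta> i \<omega>) {..<k}))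
      borel ((\<lambda>d. d k) \<circ> (\<lambda>\<omega>. restrict (\<lambda>i. \<Delta> i \<omega>) {k}))"
  proof (rule indep_var_compose)
    show "indep_var (PiM {..<k} (\<lambda>_. borel)) (\<lambda>\<omega>. restrict (\<lambda>i. \<Delta> i \<omega>) {..<k})
        (PiM {k} (\<lambda>_. borel)) (\<lambda>\<omega>. restrict (\<lambda>i. \<Delta> i \<omega>) {k})"
      by (rule indep_var_restrict[OF ind]) (use Suc.prems(1) in auto)
    show "(\<lambda>d. implicit_euler (\<sigma>\<^sup>2) d k x) \<in> borel_measurable (PiM {..<k} (\<lambda>_. borel))"
      by (rule implicit_euler_measurable[where \<Delta> = "\<lambda>d. d"]) auto
  qed simp
  also have "(\<lambda>d. implicit_euler (\<sigma>\<^sup>2) d k x) \<circ> (\<lambda>\<omega>. restrict (\<lambda>i. \<Delta> i \<omega>) {..<k}) = Z"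
    unfolding Z_def comp_def by (intro ext implicit_euler_cong) simp
  also have "(\<lambda>d. d k) \<circ> (\<lambda>\<omega>. restrict (\<lambda>i. \<Delta> i \<omega>) {k}) = \<Delta> k" by auto
  finally have Z: "indep_var borel Z borel (\<Delta> k)" .
  note [measurable] = indep_var_rv1[OF Z] indep_var_rv2[OF Z]
  interpret DZ: prob_space "distr M borel Z" by (rule prob_space_distr) simp
  interpret G: prob_space "gaussian \<sigma>" by (rule prob_space_normal_density) fact
  interpret ZG: pair_prob_space "distr M borel Z" "gaussian \<sigma>" ..
  have joint: "distr M (borel \<Otimes>\<^sub>M borel) (\<lambda>\<omega>. (Z \<omega>, \<Delta> k \<omega>)) = distr M borel Z \<Otimes>\<^sub>M gaussian \<sigma>"
    using Z distr[of k] Suc.prems(1) unfolding indep_var_distribution_eq by simp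
  have "(\<integral>\<omega>. f (implicit_euler (\<sigma>\<^sup>2) (\<lambda>i. \<Delta> i \<omega>) (Suc k) x) \<partial>M) = (\<integral>\<omega>. h (Z \<omega>, \<Delta> k \<omega>) \<partial>M)"
    by (simp add: h_def Z_def)
  also have "\<dots> = (\<integral>z. h z \<partial>(distr M borel Z \<Otimes>\<^sub>M gaussian \<sigma>))"
    unfolding joint[symmetric] by (subst integral_distr) auto
  also have "\<dots> = (\<integral>z. (\<integral>d. h (z, d) \<partial>gaussian \<sigma>) \<partial>distr M borel Z)"
  proof (rule ZG.integral_fst'[symmetric])
    have "h \<in> borel_measurable (distr M borel Z \<Otimes>\<^sub>M gaussian \<sigma>)"
      using h by (subst measurable_cong_sets[OF sets_pair_measure_cong[of _ borel _ borel] refl]) simp_all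
    then show "integrable (distr M borel Z \<Otimes>\<^sub>M gaussian \<sigma>) h"
      by (intro ZG.P.integrable_const_bound[where B = B]) (auto simp: h_def Suc.prems(3))
  qed
  also have "\<dots> = (\<integral>z. euler_kernel \<sigma> f z \<partial>distr M borel Z)"
    by (simp add: h_def euler_kernel_def[abs_def])
  also have "\<dots> = (\<integral>\<omega>. euler_kernel \<sigma> f (Z \<omega>) \<partial>M)"
  proof (rule integral_distr)
    show "euler_kernel \<sigma> f \<in> borel_measurable borel"
      by (rule borel_measurable_continuous_onI[OF lipschitz_real_continuous])
         (rule euler_kernel_lipschitz(1)[OF \<sigma> Suc.prems(2,3)])
  qed simp
  also have "\<dots> = (euler_kernel \<sigma> ^^ k) (euler_kernel \<sigma> f) x"
    unfolding Z_def using Suc.prems(1)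
    by (intro Suc.IH euler_kernel_lipschitz[OF \<sigma> Suc.prems(2,3)]) simp
  also have "\<dots> = (euler_kernel \<sigma> ^^ Suc k) f x" by (simp only: funpow_Suc_right o_apply)
  finally show ?case .
qed

lemma euler_at_expectation:
  assumes M: "prob_space M" and W: "brownian_motion M W" and "t > 0" "n > 0"
    and lip: "\<And>x y. \<bar>f x - f y\<bar> \<le> L * \<bar>x - y\<bar>" and bnd: "\<And>x. \<bar>f x\<bar> \<le> B"
  shows "(\<integral>\<omega>. f (euler_at t n x (\<lambda>s. W s \<omega>)) \<partial>M) = (euler_kernel (sqrt (t / n)) ^^ n) f x"
proof -
  interpret prob_space M by fact
  define \<tau> where "\<tau> k = t * real k / real n" for k
  have step: "\<tau> (Suc k) - \<tau> k = t / n" for k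
    unfolding \<tau>_def diff_divide_distrib[symmetric] by (simp add: algebra_simps)
  have pos: "t / n > 0" using assms by simp
  have \<tau>0: "0 \<le> \<tau> k" for k using assms by (simp add: \<tau>_def)
  have lt: "\<tau> k < \<tau> (Suc k)" for k using step[of k] pos by linarith
  define \<Delta> where "\<Delta> k \<omega> = W (\<tau> (Suc k)) \<omega> - W (\<tau> k) \<omega>" for k \<omega>
  have ind: "indep_vars (\<lambda>_. borel) \<Delta> {..<n}"
    using W lt \<tau>0 unfolding brownian_motion_def \<Delta>_def[abs_def] by (simp add: less_imp_le)
  have "distr M borel (\<Delta> k) = gaussian (sqrt (t / n))" for k
  proof -
    have "distributed M lborel (\<Delta> k) (normal_density 0 (sqrt (\<tau> (Suc k) - \<tau> k)))"
      using W lt[of k] \<tau>0[of k] unfolding brownian_motion_def \<Delta>_def[abs_def] by blast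
    then have "distr M lborel (\<Delta> k) = gaussian (sqrt (t / n))"
      unfolding step by (rule distributed_distr_eq_density)
    then show ?thesis by (simp cong: distr_cong)
  qed
  then have "(\<integral>\<omega>. f (implicit_euler ((sqrt (t / n))\<^sup>2) (\<lambda>i. \<Delta> i \<omega>) n x) \<partial>M) = (euler_kernel (sqrt (t / n)) ^^ n) f x"
    by (intro implicit_euler_expectation[OF M _ ind _ order.refl lip bnd]) (use pos in auto)
  then show ?thesis using pos by (simp add: euler_at_def \<Delta>_def \<tau>_def)
qed

end

section \<open>The flow as a functional of the driving path\<close>

abbreviation path_space :: "(real \<Rightarrow> real) measure" where
  "path_space \<equiv> \<Pi>\<^sub>M t\<in>{0..}. borel"

text \<open>
  The restriction to nonnegative times makes the sample path an element of the product space
  \<open>path_space\<close> on which independence of the driving processes is formulated.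
\<close>

definition sample_path :: "(real \<Rightarrow> 'w \<Rightarrow> real) \<Rightarrow> 'w \<Rightarrow> real \<Rightarrow> real" where
  "sample_path W \<omega> = (\<lambda>t\<in>{0..}. W t \<omega>)"

lemma sample_path_measurable:
  assumes "brownian_motion M W"
  shows "sample_path W \<in> M \<rightarrow>\<^sub>M path_space"
  unfolding sample_path_def
  by (rule measurable_restrict) (use assms in \<open>auto simp: brownian_motion_def stochastic_process_def\<close>)

context decreasing_drift
begin

text \<open>
  The limit exists for the paths that matter; elsewhere \<open>lim\<close> takes some fixed value, which keeps
  the flow measurable in the initial value and the path together. The index \<open>Suc n\<close> excludes the
  scheme without any step.
\<close>

definition flow :: "real \<Rightarrow> real \<Rightarrow> (real \<Rightarrow> real) \<Rightarrow> real" where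
  "flow t x w = lim (\<lambda>n. euler_at t (Suc n) x w)"

lemma euler_at_sample_path:
  assumes "t \<ge> 0"
  shows "euler_at t n x (sample_path W \<omega>) = euler_at t n x (\<lambda>s. W s \<omega>)"
  using assms by (simp add: euler_at_def sample_path_def)

lemma euler_at_measurable:
  assumes "t \<ge> 0"
  shows "(\<lambda>z. euler_at t n (fst z) (snd z)) \<in> borel_measurable (borel \<Otimes>\<^sub>M path_space)"
  unfolding euler_at_def
proof (rule implicit_euler_measurable)
  fix i
  have [measurable]: "(\<lambda>w. w s) \<in> borel_measurable path_space" if "s \<ge> 0" for s
    using that by (intro measurable_component_singleton) auto
  show "(\<lambda>z. snd z (t * real (Suc i) / real n) - snd z (t * real i / real n)) \<in> borel_measurable (borel \<Otimes>\<^sub>M path_space)"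
    using assms by (intro borel_measurable_diff measurable_compose[OF measurable_snd]) auto
qed (use assms in auto)

lemma flow_measurable[measurable]:
  assumes "t \<ge> 0"
  shows "(\<lambda>(x, w). flow t x w) \<in> borel_measurable (borel \<Otimes>\<^sub>M path_space)"
  unfolding flow_def case_prod_beta
  by (intro borel_measurable_lim_metric euler_at_measurable assms)

lemma flow_contraction:
  assumes "t \<ge> 0"
    and "convergent (\<lambda>n. euler_at t (Suc n) x w)" "convergent (\<lambda>n. euler_at t (Suc n) y w)"
  shows "\<bar>flow t x w - flow t y w\<bar> \<le> \<bar>x - y\<bar>"
proof (rule LIMSEQ_le_const2)
  show "(\<lambda>n. \<bar>euler_at t (Suc n) x w - euler_at t (Suc n) y w\<bar>) \<longlonglongrightarrow> \<bar>flow t x w - flow t y w\<bar>"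
    using assms unfolding flow_def convergent_LIMSEQ_iff by (intro tendsto_intros)
  show "\<exists>N. \<forall>n\<ge>N. \<bar>euler_at t (Suc n) x w - euler_at t (Suc n) y w\<bar> \<le> \<bar>x - y\<bar>"
    using assms(1) unfolding euler_at_def by (intro exI allI impI implicit_euler_contraction) simp
qed

lemma sde_solution_flow:
  assumes "t \<ge> 0" and W: "brownian_motion M W" and Y: "sde_solution M W b x Y"
  shows "AE \<omega> in M. convergent (\<lambda>n. euler_at t (Suc n) x (sample_path W \<omega>)) \<and> Y t \<omega> = flow t x (sample_path W \<omega>)"
proof -
  have "AE \<omega> in M. continuous_on {0..} (\<lambda>t. Y t \<omega>)"
    "AE \<omega> in M. \<forall>t\<ge>0. Y t \<omega> = x + integral {0..t} (\<lambda>s. b (Y s \<omega>)) + W t \<omega>"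
    "AE \<omega> in M. W 0 \<omega> = 0"
    using W Y by (auto simp: sde_solution_def brownian_motion_def)
  then show ?thesis
  proof eventually_elim
    case (elim \<omega>)
    then have "(\<lambda>n. euler_at t (Suc n) x (\<lambda>s. W s \<omega>)) \<longlonglongrightarrow> Y t \<omega>"
      using assms(1) by (intro euler_at_converges) auto
    then have "(\<lambda>n. euler_at t (Suc n) x (sample_path W \<omega>)) \<longlonglongrightarrow> Y t \<omega>"
      using assms(1) by (simp add: euler_at_sample_path)
    then show ?case by (auto simp: flow_def convergent_def limI)
  qed
qed

end

text \<open>Cosines and sines are bounded and Lipschitz, so characteristic functions are among the tests.\<close>

lemma measure_eqI_lipschitz:
  fixes M N :: "real measure"
  assumes "real_distribution M" "real_distribution N"
    and eq: "\<And>f L B. (\<And>x y. \<bar>f x - f y\<bar> \<le> L * \<bar>x - y\<bar>) \<Longrightarrow> (\<And>x. \<bar>f x\<bar> \<le> B) \<Longrightarrow>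
        (\<integral>x. f x \<partial>M) = (\<integral>x. f x \<partial>N)"
  shows "M = N"
proof (rule Levy_uniqueness[OF assms(1,2)], rule ext)
  fix t :: real
  interpret M: real_distribution M by fact
  interpret N: real_distribution N by fact
  have cos_lip: "\<bar>cos (t * x) - cos (t * y)\<bar> \<le> \<bar>t\<bar> * \<bar>x - y\<bar>" for x y
  proof -
    have "((\<lambda>x. cos (t * x)) has_field_derivative - t * sin (t * x)) (at x within UNIV)" for x
      by (auto intro!: derivative_eq_intros)
    moreover have "norm (- t * sin (t * x)) \<le> \<bar>t\<bar>" for x
      by (simp add: abs_mult mult_left_le)
    ultimately show ?thesis
      using field_differentiable_bound[of UNIV "\<lambda>x. cos (t * x)" "\<lambda>x. - t * sin (t * x)" "\<bar>t\<bar>" x y] by simp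
  qed
  have sin_lip: "\<bar>sin (t * x) - sin (t * y)\<bar> \<le> \<bar>t\<bar> * \<bar>x - y\<bar>" for x y
  proof -
    have "((\<lambda>x. sin (t * x)) has_field_derivative t * cos (t * x)) (at x within UNIV)" for x
      by (auto intro!: derivative_eq_intros)
    moreover have "norm (t * cos (t * x)) \<le> \<bar>t\<bar>" for x
      by (simp add: abs_mult mult_left_le)
    ultimately show ?thesis
      using field_differentiable_bound[of UNIV "\<lambda>x. sin (t * x)" "\<lambda>x. t * cos (t * x)" "\<bar>t\<bar>" x y] by simp
  qed
  have char_eq: "char P t = Complex (\<integral>x. cos (t * x) \<partial>P) (\<integral>x. sin (t * x) \<partial>P)"
    if "real_distribution P" for P
  proof -
    interpret real_distribution P by fact
    have int: "integrable P (\<lambda>x. iexp (t * x))" by (rule integrable_iexp) auto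
    show ?thesis
      using integral_Re[OF int] integral_Im[OF int]
      by (simp add: char_def complex_eq_iff Re_exp Im_exp)
  qed
  show "char M t = char N t"
    unfolding char_eq[OF assms(1)] char_eq[OF assms(2)]
    using eq[OF cos_lip, of 1] eq[OF sin_lip, of 1] by simp
qed

context gibbs_density
begin

text \<open>
  With \<open>n\<close> steps of length \<open>t / n\<close> the total error is of order \<open>n (t / n)\<^sup>3\<^sup>/\<^sup>2\<close>, and dominated
  convergence passes from the scheme to the flow.
\<close>

lemma flow_preserves_gibbs_integral:
  assumes M: "prob_space M" and W: "brownian_motion M W" and "t > 0"
    and conv: "\<And>x. AE \<omega> in M. convergent (\<lambda>n. euler_at t (Suc n) x (sample_path W \<omega>))"
    and lip: "\<And>x y. \<bar>f x - f y\<bar> \<le> L * \<bar>x - y\<bar>" and bnd: "\<And>x. \<bar>f x\<bar> \<le> B"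
  shows "(\<integral>x. (\<integral>\<omega>. f (flow t x (sample_path W \<omega>)) \<partial>M) \<partial>gibbs) = (\<integral>x. f x \<partial>gibbs)"
proof -
  interpret M: prob_space M by fact
  have fc: "isCont f x" for x
    using lipschitz_real_continuous[OF lip] by (simp add: continuous_on_eq_continuous_at)
  have [measurable]: "f \<in> borel_measurable borel"
    by (rule borel_measurable_continuous_onI[OF lipschitz_real_continuous[OF lip]])
  note [measurable] = sample_path_measurable[OF W]
  define \<sigma> where "\<sigma> n = sqrt (t / real (Suc n))" for n
  have \<sigma>_pos: "\<sigma> n > 0" for n using \<open>t > 0\<close> by (simp add: \<sigma>_def)
  define u where "u n = (euler_kernel (\<sigma> n) ^^ Suc n) f" for n
  have u_meas[measurable]: "u n \<in> borel_measurable borel" for n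
    unfolding u_def
    by (rule borel_measurable_continuous_onI[OF lipschitz_real_continuous])
       (rule funpow_euler_kernel_regular(1)[OF \<sigma>_pos lip bnd])
  have u_bnd: "\<bar>u n x\<bar> \<le> B" for n x
    unfolding u_def by (rule funpow_euler_kernel_regular(2)[OF \<sigma>_pos lip bnd])
  have u_lim: "(\<lambda>n. u n x) \<longlonglongrightarrow> (\<integral>\<omega>. f (flow t x (sample_path W \<omega>)) \<partial>M)" for x
  proof -
    have em[measurable]: "(\<lambda>\<omega>. euler_at t n x (sample_path W \<omega>)) \<in> borel_measurable M" for n
      using measurable_compose[OF measurable_Pair[OF measurable_const sample_path_measurable[OF W]] euler_at_measurable[of t n]]
        \<open>t > 0\<close> by simp
    have fm[measurable]: "(\<lambda>\<omega>. flow t x (sample_path W \<omega>)) \<in> borel_measurable M"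
      using measurable_compose[OF measurable_Pair[OF measurable_const sample_path_measurable[OF W]] flow_measurable[of t]]
        \<open>t > 0\<close> by simp
    have "(\<lambda>n. \<integral>\<omega>. f (euler_at t (Suc n) x (sample_path W \<omega>)) \<partial>M) \<longlonglongrightarrow> (\<integral>\<omega>. f (flow t x (sample_path W \<omega>)) \<partial>M)"
    proof (rule integral_dominated_convergence[where w = "\<lambda>_. B"])
      show "AE \<omega> in M. (\<lambda>n. f (euler_at t (Suc n) x (sample_path W \<omega>))) \<longlonglongrightarrow> f (flow t x (sample_path W \<omega>))"
        using conv[of x]
      proof eventually_elim
        case (elim \<omega>)
        then show ?case
          unfolding flow_def convergent_LIMSEQ_iff by (intro isCont_tendsto_compose[OF fc])
      qed
    qed (use bnd in auto)
    then show ?thesis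
      using \<open>t > 0\<close> euler_at_expectation[OF M W \<open>t > 0\<close> _ lip bnd]
      by (simp add: u_def \<sigma>_def euler_at_sample_path del: funpow.simps of_nat_Suc)
  qed
  have "(\<lambda>n. \<integral>x. u n x \<partial>gibbs) \<longlonglongrightarrow> (\<integral>x. (\<integral>\<omega>. f (flow t x (sample_path W \<omega>)) \<partial>M) \<partial>gibbs)"
  proof (rule integral_dominated_convergence[where w = "\<lambda>_. B"])
    show "(\<lambda>x. \<integral>\<omega>. f (flow t x (sample_path W \<omega>)) \<partial>M) \<in> borel_measurable gibbs"
      using borel_measurable_LIMSEQ_real[OF u_lim u_meas] by simp
  qed (use u_lim u_bnd in auto)
  moreover have "(\<lambda>n. \<integral>x. u n x \<partial>gibbs) \<longlonglongrightarrow> (\<integral>x. f x \<partial>gibbs)"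
  proof -
    define C where "C = L * (6 * K * (\<integral>z. 1 / (1 + z\<^sup>2) \<partial>lborel))"
    have "\<bar>(\<integral>x. u n x \<partial>gibbs) - (\<integral>x. f x \<partial>gibbs)\<bar> \<le> C * (t * \<sigma> n)" if "t \<le> real (Suc n)" for n
    proof -
      have "\<sigma> n \<le> 1" using that by (simp add: \<sigma>_def)
      then have "\<bar>(\<integral>x. u n x \<partial>gibbs) - (\<integral>x. f x \<partial>gibbs)\<bar>
          \<le> real (Suc n) * (L * (6 * K * \<sigma> n ^ 3 * (\<integral>z. 1 / (1 + z\<^sup>2) \<partial>lborel)))"
        unfolding u_def by (intro iterated_step_error[OF \<sigma>_pos _ lip bnd])
      also have "\<dots> = C * ((real (Suc n) * (\<sigma> n)\<^sup>2) * \<sigma> n)"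
        by (simp only: C_def power3_eq_cube power2_eq_square mult_ac)
      also have "real (Suc n) * (\<sigma> n)\<^sup>2 = t"
        using \<open>t > 0\<close> by (simp add: \<sigma>_def del: of_nat_Suc)
      finally show ?thesis .
    qed
    then have "\<forall>\<^sub>F n in sequentially. norm ((\<integral>x. u n x \<partial>gibbs) - (\<integral>x. f x \<partial>gibbs)) \<le> C * (t * \<sigma> n)"
      using eventually_ge_at_top[of "nat \<lceil>t\<rceil>"] by (auto elim!: eventually_mono)
    moreover have "(\<lambda>n. C * (t * \<sigma> n)) \<longlonglongrightarrow> C * (t * sqrt 0)"
      unfolding \<sigma>_def by (intro tendsto_intros LIMSEQ_Suc[OF lim_const_over_n])
    then have "(\<lambda>n. C * (t * \<sigma> n)) \<longlonglongrightarrow> 0" by simp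
    ultimately have "(\<lambda>n. (\<integral>x. u n x \<partial>gibbs) - (\<integral>x. f x \<partial>gibbs)) \<longlonglongrightarrow> 0"
      by (rule Lim_null_comparison)
    then show ?thesis by (simp add: LIM_zero_iff)
  qed
  ultimately show ?thesis by (rule LIMSEQ_unique)
qed

lemma flow_preserves_gibbs:
  assumes M: "prob_space M" and W: "brownian_motion M W" and "t \<ge> 0"
    and conv: "\<And>x. AE \<omega> in M. convergent (\<lambda>n. euler_at t (Suc n) x (sample_path W \<omega>))"
  shows "distr (gibbs \<Otimes>\<^sub>M M) borel (\<lambda>(x, \<omega>). flow t x (sample_path W \<omega>)) = gibbs"
proof (rule measure_eqI_lipschitz)
  interpret M: prob_space M by fact
  interpret GM: pair_prob_space gibbs M ..
  note [measurable] = sample_path_measurable[OF W]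
  have flow_m[measurable]: "(\<lambda>(x, \<omega>). flow t x (sample_path W \<omega>)) \<in> borel_measurable (gibbs \<Otimes>\<^sub>M M)"
  proof -
    have "(\<lambda>z. (fst z, sample_path W (snd z))) \<in> gibbs \<Otimes>\<^sub>M M \<rightarrow>\<^sub>M borel \<Otimes>\<^sub>M path_space" by measurable
    from measurable_compose[OF this flow_measurable[OF \<open>t \<ge> 0\<close>]] show ?thesis
      by (simp add: case_prod_beta)
  qed
  show "real_distribution (distr (gibbs \<Otimes>\<^sub>M M) borel (\<lambda>(x, \<omega>). flow t x (sample_path W \<omega>)))"
    by (intro GM.P.real_distribution_distr flow_m)
  show "real_distribution gibbs"
    by (simp add: real_distribution_def real_distribution_axioms_def p_prob)
  fix f :: "real \<Rightarrow> real" and L B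
  assume lip: "\<bar>f x - f y\<bar> \<le> L * \<bar>x - y\<bar>" and bnd: "\<bar>f x\<bar> \<le> B" for x y
  have [measurable]: "f \<in> borel_measurable borel"
    by (rule borel_measurable_continuous_onI[OF lipschitz_real_continuous[OF lip]])
  have "(\<integral>y. f y \<partial>distr (gibbs \<Otimes>\<^sub>M M) borel (\<lambda>(x, \<omega>). flow t x (sample_path W \<omega>)))
      = (\<integral>z. f (case z of (x, \<omega>) \<Rightarrow> flow t x (sample_path W \<omega>)) \<partial>(gibbs \<Otimes>\<^sub>M M))"
    by (rule integral_distr) auto
  also have "\<dots> = (\<integral>x. (\<integral>\<omega>. f (flow t x (sample_path W \<omega>)) \<partial>M) \<partial>gibbs)"
  proof (subst GM.integral_fst'[symmetric])
    show "integrable (gibbs \<Otimes>\<^sub>M M) (\<lambda>z. f (case z of (x, \<omega>) \<Rightarrow> flow t x (sample_path W \<omega>)))"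
      by (rule GM.P.integrable_const_bound[where B = B]) (use bnd in auto)
  qed simp
  also have "\<dots> = (\<integral>x. f x \<partial>gibbs)"
  proof (cases "t = 0")
    case True
    have "implicit_euler 0 (\<lambda>_. 0) k x = x" for k x
      by (induction k) (auto intro: resolvent_unique)
    then have "flow t x w = x" for x w
      using True by (simp add: flow_def euler_at_def del: implicit_euler.simps)
    then show ?thesis using M.prob_space by simp
  next
    case False
    then show ?thesis using \<open>t \<ge> 0\<close>
      by (intro flow_preserves_gibbs_integral[OF M W _ conv lip bnd]) auto
  qed
  finally show "(\<integral>y. f y \<partial>distr (gibbs \<Otimes>\<^sub>M M) borel (\<lambda>(x, \<omega>). flow t x (sample_path W \<omega>))) = (\<integral>x. f x \<partial>gibbs)" .
qed

end

section \<open>Infinitely many independent coordinates\<close>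

text \<open>
  For a fixed sequence of initial values the variables are independent functions of the driving
  noises. The probability of a cylinder is therefore a product of functions of single coordinates,
  whose integral with respect to the product measure factorises again.
\<close>

lemma distr_PiM_independent_maps:
  fixes N :: "nat \<Rightarrow> real measure" and S :: "nat \<Rightarrow> real \<Rightarrow> 'p \<Rightarrow> real" and X :: "nat \<Rightarrow> 'w \<Rightarrow> 'p"
  assumes N: "\<And>h. prob_space (N h)" and N_sets: "\<And>h. sets (N h) = sets borel"
    and M: "prob_space M"
    and ind: "prob_space.indep_vars M P X UNIV"
    and S: "\<And>h. (\<lambda>(x, w). S h x w) \<in> borel_measurable (borel \<Otimes>\<^sub>M P h)"
    and law: "\<And>h. distr (N h \<Otimes>\<^sub>M M) borel (\<lambda>(x, \<omega>). S h x (X h \<omega>)) = N h"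
  shows "(\<lambda>(\<xi>, \<omega>) h. S h (\<xi> h) (X h \<omega>)) \<in> PiM UNIV N \<Otimes>\<^sub>M M \<rightarrow>\<^sub>M PiM UNIV N" (is "?T \<in> _")
    and "distr (PiM UNIV N \<Otimes>\<^sub>M M) (PiM UNIV N) (\<lambda>(\<xi>, \<omega>) h. S h (\<xi> h) (X h \<omega>)) = PiM UNIV N"
proof -
  interpret Q: prob_space M by fact
  interpret product_prob_space N UNIV by (rule product_prob_spaceI) fact
  interpret NM: pair_prob_space "PiM UNIV N" M ..
  have X[measurable]: "X h \<in> M \<rightarrow>\<^sub>M P h" for h
    using ind by (simp add: Q.indep_vars_def)
  have coord[measurable]: "(\<lambda>\<xi>. \<xi> h) \<in> borel_measurable (PiM UNIV N)" for h
  proof -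
    have "(\<lambda>\<xi>. \<xi> h) \<in> PiM UNIV N \<rightarrow>\<^sub>M N h" by (rule measurable_component_singleton) simp
    then show ?thesis by (simp add: N_sets cong: measurable_cong_sets)
  qed
  have T_comp[measurable]: "(\<lambda>z. S h (fst z h) (X h (snd z))) \<in> borel_measurable (PiM UNIV N \<Otimes>\<^sub>M M)" for h
  proof -
    have "(\<lambda>z. (fst z h, X h (snd z))) \<in> PiM UNIV N \<Otimes>\<^sub>M M \<rightarrow>\<^sub>M borel \<Otimes>\<^sub>M P h"
      by measurable
    from measurable_compose[OF this S] show ?thesis by simp
  qed
  have SX[measurable]: "(\<lambda>\<omega>. S h x (X h \<omega>)) \<in> borel_measurable M" for h x
    using measurable_compose[OF measurable_Pair[OF measurable_const X] S, of x h] by simp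
  show T: "?T \<in> PiM UNIV N \<Otimes>\<^sub>M M \<rightarrow>\<^sub>M PiM UNIV N"
    unfolding case_prod_beta
  proof (rule measurable_PiM_single')
    show "(\<lambda>z. S h (fst z h) (X h (snd z))) \<in> PiM UNIV N \<Otimes>\<^sub>M M \<rightarrow>\<^sub>M N h" for h
      using T_comp[of h] by (simp add: N_sets cong: measurable_cong_sets)
    show "(\<lambda>z h. S h (fst z h) (X h (snd z))) \<in> space (PiM UNIV N \<Otimes>\<^sub>M M) \<rightarrow> (\<Pi>\<^sub>E i\<in>UNIV. space (N i))"
      using sets_eq_imp_space_eq[OF N_sets] by auto
  qed
  show "distr (PiM UNIV N \<Otimes>\<^sub>M M) (PiM UNIV N) ?T = PiM UNIV N"
  proof (rule measure_eqI_PiM_infinite)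
    show "finite_measure (distr (PiM UNIV N \<Otimes>\<^sub>M M) (PiM UNIV N) ?T)"
      by (rule NM.P.finite_measure_distr[OF T])
    fix A and J :: "nat set"
    assume J: "finite J" "J \<subseteq> UNIV" and A: "\<And>i. i \<in> J \<Longrightarrow> A i \<in> sets (N i)"
    have A': "A i \<in> sets borel" if "i \<in> J" for i using A[OF that] by (simp add: N_sets)
    define E where "E = {z \<in> space (PiM UNIV N \<Otimes>\<^sub>M M). \<forall>j\<in>J. S j (fst z j) (X j (snd z)) \<in> A j}"
    define g where "g j x = emeasure M {\<omega> \<in> space M. S j x (X j \<omega>) \<in> A j}" for j x
    have [measurable]: "E \<in> sets (PiM UNIV N \<Otimes>\<^sub>M M)"
      unfolding E_def
    proof (intro sets.sets_Collect_finite_All J(1))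
      fix j assume "j \<in> J"
      from measurable_sets[OF T_comp A'[OF this], of j]
      show "{z \<in> space (PiM UNIV N \<Otimes>\<^sub>M M). S j (fst z j) (X j (snd z)) \<in> A j} \<in> sets (PiM UNIV N \<Otimes>\<^sub>M M)"
        by (simp add: vimage_def Int_def conj_commute)
    qed
    have NS[measurable]: "(\<lambda>z. S j (fst z) (X j (snd z))) \<in> borel_measurable (N j \<Otimes>\<^sub>M M)" for j
    proof -
      have "(\<lambda>z. (fst z, X j (snd z))) \<in> N j \<Otimes>\<^sub>M M \<rightarrow>\<^sub>M borel \<Otimes>\<^sub>M P j"
        using measurable_fst[of "N j" M]
        by (intro measurable_Pair measurable_compose[OF measurable_snd X])
           (simp add: N_sets cong: measurable_cong_sets)
      from measurable_compose[OF this S] show ?thesis by simp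
    qed
    have slice: "emeasure M (Pair x -` B) = g j x"
      if "B = {z \<in> space (N j \<Otimes>\<^sub>M M). S j (fst z) (X j (snd z)) \<in> A j}" for B j x
      unfolding g_def that by (intro arg_cong[where f = "emeasure M"])
        (auto simp: space_pair_measure sets_eq_imp_space_eq[OF N_sets])
    have B_sets: "{z \<in> space (N j \<Otimes>\<^sub>M M). S j (fst z) (X j (snd z)) \<in> A j} \<in> sets (N j \<Otimes>\<^sub>M M)"
      if "j \<in> J" for j
      using measurable_sets[OF NS A'[OF that], of j] by (simp add: vimage_def Int_def conj_commute)
    have g_meas: "g j \<in> borel_measurable (N j)" if "j \<in> J" for j
      using Q.measurable_emeasure_Pair[OF B_sets[OF that]] unfolding slice[OF refl] .
    have g_int: "integral\<^sup>N (N j) (g j) = emeasure (N j) (A j)" if "j \<in> J" for j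
    proof -
      have "integral\<^sup>N (N j) (g j) = emeasure (N j \<Otimes>\<^sub>M M) {z \<in> space (N j \<Otimes>\<^sub>M M). S j (fst z) (X j (snd z)) \<in> A j}"
        using Q.emeasure_pair_measure_alt[OF B_sets[OF that]] unfolding slice[OF refl] by (rule sym)
      also have "\<dots> = emeasure (distr (N j \<Otimes>\<^sub>M M) borel (\<lambda>(x, \<omega>). S j x (X j \<omega>))) (A j)"
        using A'[OF that] NS[of j] by (subst emeasure_distr)
          (auto simp: case_prod_beta intro!: arg_cong[where f = "emeasure (N j \<Otimes>\<^sub>M M)"])
      finally show ?thesis by (simp add: law)
    qed
    have indep_slice: "emeasure M (Pair \<xi> -` E) = (\<Prod>j\<in>J. g j (\<xi> j))" if "\<xi> \<in> space (PiM UNIV N)" for \<xi>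
    proof (cases "J = {}")
      case True
      then have "Pair \<xi> -` E = space M" using that by (auto simp: E_def space_pair_measure)
      then show ?thesis using True by (simp add: Q.emeasure_space_1)
    next
      case False
      have "Q.indep_vars (\<lambda>_. borel) (\<lambda>h \<omega>. S h (\<xi> h) (X h \<omega>)) UNIV"
        by (rule Q.indep_vars_compose2[OF ind])
           (use measurable_compose[OF measurable_Pair1'[of "\<xi> _" borel] S] in simp)
      from Q.indep_varsD[OF this False J A']
      have "Q.prob (\<Inter>j\<in>J. (\<lambda>\<omega>. S j (\<xi> j) (X j \<omega>)) -` A j \<inter> space M)
          = (\<Prod>j\<in>J. Q.prob ((\<lambda>\<omega>. S j (\<xi> j) (X j \<omega>)) -` A j \<inter> space M))" by simp
      moreover have "(\<Inter>j\<in>J. (\<lambda>\<omega>. S j (\<xi> j) (X j \<omega>)) -` A j \<inter> space M) = Pair \<xi> -` E"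
        using False that by (auto simp: E_def space_pair_measure)
      moreover have "(\<lambda>\<omega>. S j (\<xi> j) (X j \<omega>)) -` A j \<inter> space M = {\<omega> \<in> space M. S j (\<xi> j) (X j \<omega>) \<in> A j}" for j
        by auto
      ultimately show ?thesis
        by (simp add: g_def Q.emeasure_eq_measure prod_ennreal)
    qed
    have emb: "?T -` prod_emb UNIV N J (Pi\<^sub>E J A) \<inter> space (PiM UNIV N \<Otimes>\<^sub>M M) = E"
      by (auto simp: E_def prod_emb_def PiE_iff sets_eq_imp_space_eq[OF N_sets] extensional_def)
    have "emeasure (distr (PiM UNIV N \<Otimes>\<^sub>M M) (PiM UNIV N) ?T) (prod_emb UNIV N J (Pi\<^sub>E J A))
        = emeasure (PiM UNIV N \<Otimes>\<^sub>M M) E"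
      unfolding emb[symmetric] by (rule emeasure_distr[OF T]) (use J A in auto)
    also have "\<dots> = (\<integral>\<^sup>+\<xi>. emeasure M (Pair \<xi> -` E) \<partial>PiM UNIV N)"
      by (rule Q.emeasure_pair_measure_alt) measurable
    also have "\<dots> = (\<integral>\<^sup>+\<xi>. (\<Prod>j\<in>J. g j (restrict \<xi> J j)) \<partial>PiM UNIV N)"
      by (intro nn_integral_cong) (simp add: indep_slice cong: prod.cong)
    also have "\<dots> = (\<integral>\<^sup>+\<xi>. (\<Prod>j\<in>J. g j (\<xi> j)) \<partial>distr (PiM UNIV N) (PiM J N) (\<lambda>\<xi>. restrict \<xi> J))"
      using g_meas J
      by (intro nn_integral_distr[symmetric] measurable_restrict_subset borel_measurable_prod
            measurable_compose[OF measurable_component_singleton]) auto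
    also have "\<dots> = (\<integral>\<^sup>+\<xi>. (\<Prod>j\<in>J. g j (\<xi> j)) \<partial>PiM J N)"
      by (simp only: distr_PiM_restrict_finite[OF J])
    also have "\<dots> = (\<Prod>j\<in>J. integral\<^sup>N (N j) (g j))"
      by (rule product_nn_integral_prod[OF J(1) g_meas])
    also have "\<dots> = (\<Prod>j\<in>J. emeasure (N j) (A j))" by (simp add: g_int)
    also have "\<dots> = emeasure (PiM UNIV N) (prod_emb UNIV N J (Pi\<^sub>E J A))"
      using emeasure_PiM_emb[OF J(2,1) A] by simp
    finally show "emeasure (distr (PiM UNIV N \<Otimes>\<^sub>M M) (PiM UNIV N) ?T) (prod_emb UNIV N J (Pi\<^sub>E J A))
        = emeasure (PiM UNIV N) (prod_emb UNIV N J (Pi\<^sub>E J A))" .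
  qed simp_all
qed

lemma nu1_sets[simp]: "sets (nu1 m \<mu>) = sets borel"
  by (simp add: nu1_def)

lemma nu_on_sequences_coordinate[measurable]:
  "(\<lambda>\<xi>. \<xi> h) \<in> borel_measurable (nu_on_sequences m \<mu>)"
proof -
  have "(\<lambda>\<xi>. \<xi> h) \<in> nu_on_sequences m \<mu> \<rightarrow>\<^sub>M nu1 m (\<mu> h)"
    unfolding nu_on_sequences_def by (rule measurable_component_singleton) simp
  then show ?thesis by (simp cong: measurable_cong_sets)
qed

text \<open>The expected squared norm is a multiple of the sum of the \<open>\<mu> h powr (1 / m)\<close>.\<close>

lemma nu_on_sequences_square_summable:
  assumes m: "m \<ge> 1" and \<mu>: "\<And>h. \<mu> h > 0" and sm: "summable (\<lambda>h. \<mu> h powr (1 / m))"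
  shows "AE \<xi> in nu_on_sequences m \<mu>. summable (\<lambda>h. (\<xi> h)\<^sup>2)"
proof -
  interpret product_prob_space "\<lambda>h. nu1 m (\<mu> h)" UNIV
    by (rule product_prob_spaceI) (rule prob_space_nu1[OF m \<mu>])
  define I where "I = (\<integral>\<^sup>+x. ennreal (x\<^sup>2) \<partial>nu1 m 1)"
  have "(\<integral>\<^sup>+\<xi>. (\<Sum>h. ennreal ((\<xi> h)\<^sup>2)) \<partial>nu_on_sequences m \<mu>) = (\<Sum>h. \<integral>\<^sup>+\<xi>. ennreal ((\<xi> h)\<^sup>2) \<partial>nu_on_sequences m \<mu>)"
    by (rule nn_integral_suminf) measurable
  also have "\<dots> = (\<Sum>h. ennreal (\<mu> h powr (1 / m)) * I)"
  proof (rule suminf_cong)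
    fix h
    have "(\<integral>\<^sup>+x. ennreal (x\<^sup>2) \<partial>nu1 m (\<mu> h))
        = (\<integral>\<^sup>+x. ennreal (x\<^sup>2) \<partial>distr (nu_on_sequences m \<mu>) (nu1 m (\<mu> h)) (\<lambda>\<xi>. \<xi> h))"
      unfolding nu_on_sequences_def by (simp only: PiM_component[OF UNIV_I])
    also have "\<dots> = (\<integral>\<^sup>+\<xi>. ennreal ((\<xi> h)\<^sup>2) \<partial>nu_on_sequences m \<mu>)"
    proof (rule nn_integral_distr)
      show "(\<lambda>\<xi>. \<xi> h) \<in> nu_on_sequences m \<mu> \<rightarrow>\<^sub>M nu1 m (\<mu> h)"
        unfolding nu_on_sequences_def by (rule measurable_component_singleton) simp
      show "(\<lambda>x. ennreal (x\<^sup>2)) \<in> borel_measurable (distr (nu_on_sequences m \<mu>) (nu1 m (\<mu> h)) (\<lambda>\<xi>. \<xi> h))"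
        by (subst measurable_cong_sets[OF _ refl, of _ borel]) simp_all
    qed
    finally show "(\<integral>\<^sup>+\<xi>. ennreal ((\<xi> h)\<^sup>2) \<partial>nu_on_sequences m \<mu>) = ennreal (\<mu> h powr (1 / m)) * I"
      using nu1_second_moment_scaling[OF m \<mu>[of h]] by (simp add: I_def)
  qed
  also have "\<dots> = ennreal (\<Sum>h. \<mu> h powr (1 / m)) * I"
    using sm by (simp add: suminf_ennreal2)
  also have "\<dots> < \<infinity>"
    using nu1_second_moment_finite[OF m] by (simp add: I_def ennreal_mult_less_top)
  finally have "AE \<xi> in nu_on_sequences m \<mu>. (\<Sum>h. ennreal ((\<xi> h)\<^sup>2)) \<noteq> \<infinity>"
    by (intro nn_integral_noteq_infinite) auto
  then show ?thesis
    by eventually_elim (auto intro: summable_suminf_not_top)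
qed

lemma measurable_augmented_filtration:
  assumes W: "brownian_motion M W" and f: "f \<in> borel_measurable (augmented_filtration M W t)"
  shows "f \<in> borel_measurable M"
proof (rule measurable_from_subalg[OF _ f])
  have gen: "{W s -` A \<inter> space M | s A. 0 \<le> s \<and> s \<le> t \<and> A \<in> sets borel} \<union> null_sets M \<subseteq> sets M"
    using W by (auto simp: brownian_motion_def stochastic_process_def intro: measurable_sets)
  then have "{W s -` A \<inter> space M | s A. 0 \<le> s \<and> s \<le> t \<and> A \<in> sets borel} \<union> null_sets M \<subseteq> Pow (space M)"
    using sets.space_closed by blast
  then show "subalgebra M (augmented_filtration M W t)"
    unfolding subalgebra_def augmented_filtration_def using gen by (simp add: sets.sigma_sets_subset)
qed

theorem proposition7p5:
  fixes e :: "nat \<Rightarrow> 'a::{real_inner, banach, second_countable_topology}"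
    and m :: real and \<mu> :: "nat \<Rightarrow> real"
    and M :: "'w measure"
    and W :: "nat \<Rightarrow> real \<Rightarrow> 'w \<Rightarrow> real"
    and Xh :: "nat \<Rightarrow> real \<Rightarrow> real \<Rightarrow> 'w \<Rightarrow> real"
  assumes "orthonormal_basis e"
    and "m \<ge> 1"
    and "\<And>h. \<mu> h > 0"
    and "summable (\<lambda>h. \<mu> h powr (1 / m))"
    and "prob_space M"
    and "\<And>h. brownian_motion M (W h)"
    and "independent_processes M W"
    and "\<And>h \<xi>. sde_solution M (W h) (drift m (\<mu> h)) \<xi> (\<lambda>t. Xh h t \<xi>)"
  shows "(\<forall>x. (\<forall>t\<ge>0. AE \<omega> in M. summable (\<lambda>h. Xh h t (x \<bullet> e h) \<omega> *\<^sub>R e h)) \<and>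
              stochastic_process M (\<lambda>t. process e Xh t x)) \<and>
         invariant_measure (transition_semigroup M (process e Xh)) (nu e m \<mu>)"
proof -
  interpret M: prob_space M by fact
  note m = \<open>m \<ge> 1\<close> and \<mu> = assms(3) and W = assms(6)
  have on: "\<And>i j. e i \<bullet> e j = (if i = j then 1 else 0)"
    using assms(1) by (simp add: orthonormal_basis_def)
  have prob1: "prob_space (nu1 m (\<mu> h))" for h by (rule prob_space_nu1[OF m \<mu>])
  define N where "N = nu_on_sequences m \<mu>"
  interpret N: prob_space N
    unfolding N_def nu_on_sequences_def by (rule prob_space_PiM) (rule prob1)
  interpret NM: pair_prob_space N M ..
  have [measurable]: "(\<lambda>\<xi>. \<xi> h) \<in> borel_measurable N" for h
    unfolding N_def by measurable
  have drift_dec: "decreasing_drift (drift m (\<mu> h))" for h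
    using gibbs_density_density1[OF m \<mu>[of h]] by (auto dest: gibbs_density.axioms(1))
  define S where "S h = decreasing_drift.flow (drift m (\<mu> h))" for h
  define conv where "conv h t x \<omega> \<longleftrightarrow>
    convergent (\<lambda>n. decreasing_drift.euler_at (drift m (\<mu> h)) t (Suc n) x (sample_path (W h) \<omega>))" for h t x \<omega>
  have S_meas: "(\<lambda>(x, w). S h t x w) \<in> borel_measurable (borel \<Otimes>\<^sub>M path_space)" if "t \<ge> 0" for h t
    unfolding S_def by (rule decreasing_drift.flow_measurable[OF drift_dec that])
  have S_sol: "AE \<omega> in M. conv h t x \<omega> \<and> Xh h t x \<omega> = S h t x (sample_path (W h) \<omega>)" if "t \<ge> 0" for h t x
    unfolding S_def conv_def by (rule decreasing_drift.sde_solution_flow[OF drift_dec that W assms(8)])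
  have S_contr: "\<bar>S h t x (sample_path (W h) \<omega>) - S h t y (sample_path (W h) \<omega>)\<bar> \<le> \<bar>x - y\<bar>"
    if "t \<ge> 0" "conv h t x \<omega>" "conv h t y \<omega>" for h t x y \<omega>
    using that unfolding S_def conv_def by (rule decreasing_drift.flow_contraction[OF drift_dec])
  have S_law: "distr (nu1 m (\<mu> h) \<Otimes>\<^sub>M M) borel (\<lambda>(x, \<omega>). S h t x (sample_path (W h) \<omega>)) = nu1 m (\<mu> h)"
    if "t \<ge> 0" for h t
  proof -
    obtain q K where g: "gibbs_density (drift m (\<mu> h)) (density1 m (\<mu> h)) q K"
      using gibbs_density_density1[OF m \<mu>[of h]] by blast
    have "AE \<omega> in M. conv h t x \<omega>" for x using S_sol[OF that, of h x] by auto
    then show ?thesis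
      unfolding S_def conv_def nu1_density1
      by (rule gibbs_density.flow_preserves_gibbs[OF g assms(5) W that])
  qed
  have ind: "M.indep_vars (\<lambda>_. path_space) (\<lambda>h. sample_path (W h)) UNIV"
    using assms(7) by (simp add: independent_processes_def sample_path_def[abs_def])
  define T where "T t = (\<lambda>(\<xi>, \<omega>) h. S h t (\<xi> h) (sample_path (W h) \<omega>))" for t
  have T_meas: "T t \<in> N \<Otimes>\<^sub>M M \<rightarrow>\<^sub>M N" and T_law: "distr (N \<Otimes>\<^sub>M M) N (T t) = N" if "t \<ge> 0" for t
    using distr_PiM_independent_maps[where N = "\<lambda>h. nu1 m (\<mu> h)" and S = "\<lambda>h. S h t" and X = "\<lambda>h. sample_path (W h)"
        and P = "\<lambda>_. path_space" and M = M, OF prob1 nu1_sets assms(5) ind S_meas[OF that] S_law[OF that]]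
    unfolding T_def N_def nu_on_sequences_def by simp_all
  have N_summable: "AE \<xi> in N. summable (\<lambda>h. (\<xi> h)\<^sup>2)"
    unfolding N_def by (rule nu_on_sequences_square_summable[OF m \<mu> assms(4)])

  have summable_sol: "AE \<omega> in M. summable (\<lambda>h. (Xh h t (x \<bullet> e h) \<omega>)\<^sup>2)" if "t \<ge> 0" for t x
  proof -
    have "AE \<eta> in distr (N \<Otimes>\<^sub>M M) N (T t). summable (\<lambda>h. (\<eta> h)\<^sup>2)"
      unfolding T_law[OF that] by (rule N_summable)
    then have "AE z in N \<Otimes>\<^sub>M M. summable (\<lambda>h. (T t z h)\<^sup>2)"
      by (rule AE_distrD[OF T_meas[OF that]])
    then have "AE \<xi> in N. AE \<omega> in M. summable (\<lambda>h. (T t (\<xi>, \<omega>) h)\<^sup>2)"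
      by (rule NM.AE_pair)
    with N_summable have "AE \<xi> in N. summable (\<lambda>h. (\<xi> h)\<^sup>2) \<and> (AE \<omega> in M. summable (\<lambda>h. (T t (\<xi>, \<omega>) h)\<^sup>2))"
      by eventually_elim simp
    from eventually_happens'[OF N.ae_filter_bot this]
    obtain \<xi> where \<xi>: "summable (\<lambda>h. (\<xi> h)\<^sup>2)" "AE \<omega> in M. summable (\<lambda>h. (S h t (\<xi> h) (sample_path (W h) \<omega>))\<^sup>2)"
      by (auto simp: T_def)
    \<comment> \<open>compare the solution from \<open>x\<close> with the one from the typical point \<open>\<xi>\<close>\<close>
    have diff: "summable (\<lambda>h. (x \<bullet> e h - \<xi> h)\<^sup>2)"
      by (rule square_summable_perturb[OF bessel_summable[OF on] \<xi>(1)]) (rule abs_triangle_ineq4)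
    have "AE \<omega> in M. \<forall>h. conv h t (x \<bullet> e h) \<omega> \<and> Xh h t (x \<bullet> e h) \<omega> = S h t (x \<bullet> e h) (sample_path (W h) \<omega>)"
      "AE \<omega> in M. \<forall>h. conv h t (\<xi> h) \<omega> \<and> Xh h t (\<xi> h) \<omega> = S h t (\<xi> h) (sample_path (W h) \<omega>)"
      unfolding AE_all_countable using S_sol[OF that] by blast+
    with \<xi>(2) show ?thesis
    proof eventually_elim
      case (elim \<omega>)
      show ?case
      proof (rule square_summable_perturb[OF diff elim(1)])
        fix h
        show "\<bar>Xh h t (x \<bullet> e h) \<omega>\<bar> \<le> \<bar>x \<bullet> e h - \<xi> h\<bar> + \<bar>S h t (\<xi> h) (sample_path (W h) \<omega>)\<bar>"
          using S_contr[OF that, of h "x \<bullet> e h" \<omega> "\<xi> h"] elim(2,3) by fastforce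
      qed
    qed
  qed

  have Xh_meas: "Xh h t \<xi> \<in> borel_measurable M" if "t \<ge> 0" for h t \<xi>
    using assms(8)[of h \<xi>] that by (auto simp: sde_solution_def intro: measurable_augmented_filtration[OF W])
  have process_meas: "process e Xh t x \<in> borel_measurable M" if "t \<ge> 0" for t x
    unfolding process_def[abs_def] using Xh_meas[OF that]
    by (intro borel_measurable_suminf borel_measurable_scaleR) auto

  have J_meas[measurable]: "(\<lambda>\<xi>. \<Sum>h. \<xi> h *\<^sub>R e h) \<in> borel_measurable N"
    unfolding N_def by (rule measurable_sequence_to_space)
  have nu_eq: "nu e m \<mu> = distr N borel (\<lambda>\<xi>. \<Sum>h. \<xi> h *\<^sub>R e h)"
    by (simp add: nu_def N_def)
  interpret nu: prob_space "nu e m \<mu>"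
    unfolding nu_eq by (rule N.prob_space_distr) measurable

  have "invariant_measure (transition_semigroup M (process e Xh)) (nu e m \<mu>)"
    unfolding invariant_measure_def
  proof (intro allI impI ballI)
    fix t :: real and \<phi> :: "'a \<Rightarrow> real"
    assume t: "t \<ge> 0" and \<phi>: "\<phi> \<in> bcontfun"
    have [measurable]: "\<phi> \<in> borel_measurable borel"
      using \<phi> by (intro borel_measurable_continuous_onI) (simp add: bcontfun_def)
    obtain B where B: "\<And>x. \<bar>\<phi> x\<bar> \<le> B"
      using \<phi> by (auto simp: bcontfun_def bounded_iff)
    define \<Phi> where "\<Phi> x \<omega> = (\<Sum>h. S h t (x \<bullet> e h) (sample_path (W h) \<omega>) *\<^sub>R e h)" for x \<omega>
    have \<Phi>_comp: "(\<lambda>z. S h t (fst z \<bullet> e h) (sample_path (W h) (snd z))) \<in> borel_measurable (borel \<Otimes>\<^sub>M M)" for h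
    proof -
      note [measurable] = sample_path_measurable[OF W[of h]]
      have "(\<lambda>z. (fst z \<bullet> e h, sample_path (W h) (snd z))) \<in> (borel :: 'a measure) \<Otimes>\<^sub>M M \<rightarrow>\<^sub>M borel \<Otimes>\<^sub>M path_space"
        by measurable
      from measurable_compose[OF this S_meas[OF t]] show ?thesis by simp
    qed
    have \<Phi>_meas[measurable]: "(\<lambda>z. \<Phi> (fst z) (snd z)) \<in> borel_measurable (borel \<Otimes>\<^sub>M M)"
      unfolding \<Phi>_def using \<Phi>_comp by (intro borel_measurable_suminf borel_measurable_scaleR) auto
    have \<Phi>_slice[measurable]: "\<Phi> x \<in> borel_measurable M" for x
      using measurable_compose[OF measurable_Pair1' \<Phi>_meas, of x] by simp
    have P_eq: "transition_semigroup M (process e Xh) t \<phi> x = (\<integral>\<omega>. \<phi> (\<Phi> x \<omega>) \<partial>M)" for x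
      unfolding transition_semigroup_def
    proof (rule integral_cong_AE)
      have "AE \<omega> in M. \<forall>h. conv h t (x \<bullet> e h) \<omega> \<and> Xh h t (x \<bullet> e h) \<omega> = S h t (x \<bullet> e h) (sample_path (W h) \<omega>)"
        unfolding AE_all_countable using S_sol[OF t] by blast
      then show "AE \<omega> in M. \<phi> (process e Xh t x \<omega>) = \<phi> (\<Phi> x \<omega>)"
        by eventually_elim (simp add: process_def \<Phi>_def)
    qed (use process_meas[OF t] in \<open>auto intro: measurable_compose\<close>)
    have P_meas[measurable]: "transition_semigroup M (process e Xh) t \<phi> \<in> borel_measurable borel"
      unfolding P_eq[abs_def] by measurable
    have P_bound: "\<bar>transition_semigroup M (process e Xh) t \<phi> x\<bar> \<le> B" for x
    proof -
      have int: "integrable M (\<lambda>\<omega>. \<phi> (\<Phi> x \<omega>))"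
        by (rule M.integrable_const_bound[where B = B]) (use B in auto)
      have "\<bar>\<integral>\<omega>. \<phi> (\<Phi> x \<omega>) \<partial>M\<bar> \<le> (\<integral>\<omega>. \<bar>\<phi> (\<Phi> x \<omega>)\<bar> \<partial>M)"
        using integral_norm_bound[of M "\<lambda>\<omega>. \<phi> (\<Phi> x \<omega>)"] by simp
      also have "\<dots> \<le> B" by (rule M.integral_le_const) (use int B in auto)
      finally show ?thesis unfolding P_eq .
    qed
    have "integrable (nu e m \<mu>) (transition_semigroup M (process e Xh) t \<phi>)"
      by (rule nu.integrable_const_bound[where B = B]) (use P_bound in \<open>auto simp: nu_def\<close>)
    moreover have "(\<integral>x. transition_semigroup M (process e Xh) t \<phi> x \<partial>nu e m \<mu>) = (\<integral>x. \<phi> x \<partial>nu e m \<mu>)"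
    proof -
      define J where "J \<xi> = (\<Sum>h. \<xi> h *\<^sub>R e h)" for \<xi> :: "nat \<Rightarrow> real"
      have J[measurable]: "J \<in> borel_measurable N" using J_meas by (simp add: J_def[abs_def])
      note [measurable] = T_meas[OF t]
      have "(\<integral>x. transition_semigroup M (process e Xh) t \<phi> x \<partial>nu e m \<mu>)
          = (\<integral>\<xi>. transition_semigroup M (process e Xh) t \<phi> (J \<xi>) \<partial>N)"
        unfolding nu_eq J_def by (rule integral_distr) measurable
      also have "\<dots> = (\<integral>\<xi>. (\<integral>\<omega>. \<phi> (J (T t (\<xi>, \<omega>))) \<partial>M) \<partial>N)"
      proof (rule integral_cong_AE)
        show "AE \<xi> in N. transition_semigroup M (process e Xh) t \<phi> (J \<xi>) = (\<integral>\<omega>. \<phi> (J (T t (\<xi>, \<omega>))) \<partial>M)"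
          using N_summable
        proof eventually_elim
          case (elim \<xi>)
          have "J \<xi> \<bullet> e h = \<xi> h" for h
            unfolding J_def by (rule orthonormal_coeff[OF on orthonormal_summable[OF on elim]])
          then show ?case by (simp add: P_eq \<Phi>_def J_def T_def)
        qed
      qed measurable
      also have "\<dots> = (\<integral>z. \<phi> (J (T t z)) \<partial>(N \<Otimes>\<^sub>M M))"
        by (rule NM.integral_fst', rule NM.P.integrable_const_bound[where B = B]) (use B in auto)
      also have "\<dots> = (\<integral>\<eta>. \<phi> (J \<eta>) \<partial>distr (N \<Otimes>\<^sub>M M) N (T t))"
        by (rule integral_distr[symmetric]) measurable
      also have "\<dots> = (\<integral>\<eta>. \<phi> (J \<eta>) \<partial>N)" unfolding T_law[OF t] ..
      also have "\<dots> = (\<integral>x. \<phi> x \<partial>nu e m \<mu>)"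
        unfolding nu_eq J_def by (rule integral_distr[symmetric]) measurable
      finally show ?thesis .
    qed
    ultimately show "integrable (nu e m \<mu>) (transition_semigroup M (process e Xh) t \<phi>) \<and>
        (\<integral>x. transition_semigroup M (process e Xh) t \<phi> x \<partial>nu e m \<mu>) = (\<integral>x. \<phi> x \<partial>nu e m \<mu>)" by blast
  qed
  moreover have "AE \<omega> in M. summable (\<lambda>h. Xh h t (x \<bullet> e h) \<omega> *\<^sub>R e h)" if "t \<ge> 0" for t x
    using summable_sol[OF that, of x]
  proof eventually_elim
    case (elim \<omega>)
    then show ?case by (rule orthonormal_summable[OF on])
  qed
  ultimately show ?thesis
    using process_meas by (auto simp: stochastic_process_def)
qed

end
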